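(* Every graph $(G,\ell_G)\in\mathcal{G}_{or(n)}$ that is canonically self-dual, canonically self-Petrial, or canonically self-Wilsonial (respectively, canonically self-trial) is in the orbit $Orb(H,\ell_H)$ of an OEB $(H,\ell_H)\in\mathcal{G}_{or(n)}$ that is canonically self-$\hat\gamma'$ for some $\hat\gamma'\in\mathfrak{S}^n$ of order $2$ (respectively, $3$).
   Context: **Ribbon graphs.** "Graph" means ribbon graph. A ribbon graph $G=(V(G),E(G))$ is a surface with boundary presented as the union of a set $V(G)$ of discs (vertices) and a set $E(G)$ of discs (edges) such that vertices and edges intersect in disjoint line segments, each such segment lies on the boundary of precisely one vertex and precisely one edge, and every edge contains exactly two such segments. Two ribbon graphs are isomorphic if there is a homeomorphism (not required to preserve any orientation) taking vertices to vertices and edges to edges; equivalently, if the corresponding cellularly embedded graphs are isomorphic. An OEB (orientable embedded bouquet) is a ribbon graph with exactly one vertex that is orientable as a surface. **Arrow presentations.** A ribbon graph is encoded by drawing each vertex boundary as a circle and recording, for each edge $e$, two directed arcs (arrows) labelled $e$ on the circles, namely the two segments where $e$ meets vertices, directed by an arbitrary orientation of the boundary of the disc $e$. **Operations on one edge.** Let $A,B$ be the two arrows labelled $e$. The partial Petrial (twist) $\tau$ at $e$ reverses the direction of exactly one of $A,B$. The partial dual $\delta$ at $e$: draw a segment with an arrow on it labelled $e$ directed from the head of $A$ to the tail of $B$, and another with an arrow labelled $e$ directed from the head of $B$ to the tail of $A$; then delete $A$, $B$ and the arcs containing them. Vertices may change; the set of edges (labels) is unchanged. It is known that the group $\mathfrak{S}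 = \langle \delta,\tau \mid \delta^2,\tau^2,(\tau\delta)^3\rangle \cong S_3$ thereby acts on the left on any fixed edge (in a product the rightmost factor is applied first), and operations on distinct edges commute. **Ordered graphs.** $[n]=\{1,\dots,n\}$. $\mathcal{G}_{or(n)}$ is the set of isomorphism classes of pairs $(G,\ell)$, where $G$ is a ribbon graph with exactly $n$ edges and $\ell\colon[n]\to E(G)$ is a bijection (a linear ordering of the edges). $(G,\ell_G)$ and $(H,\ell_H)$ are isomorphic if there is a ribbon graph isomorphism $G\to H$ whose edge bijection $g$ satisfies $g\circ\ell_G=\ell_H$. Calling $(H,\ell_H)$ an OEB means that the underlying ribbon graph $H$ is an OEB. **Group action.** An element $\hat\gamma\in\mathfrak{S}^n$ is regarded as a map $[n]\to\mathfrak{S}$; multiplication and inversion in $\mathfrak{S}^n$ are entrywise, and $\hat\gamma\pi$, for $\pi\in S_n$, is composition of maps. $G^{\Gamma(\hat\gamma,\ell)}$ denotes the ribbon graph obtained from $G$ by applying to each edge $e$ the operation $\hat\gamma(\ell^{-1}(e))$. The group $\mathfrak{S}^n\rtimes S_n$, with multiplication $(\hat\gamma_1,\pi_1)(\hat\gamma_2,\pi_2)=(\hat\gamma_1\cdot\hat\gamma_2\pi_1^{-1},\pi_1\pi_2)$, acts on $\mathcal{G}_{or(n)}$ by $(\hat\gamma,\pi)(G,\ell)=(G^{\Gamma(\hat\gamma,\ell\pi^{-1})},\ell\pi^{-1})$. The identity of $S_n$ is $\iota$. $Orb(H,\ell_H)$ is the orbit of $(H,\ell_H)$ under $\mathfrak{S}^n\rtimes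 S_n$. **Canonical self-twuality.** $(G,\ell)$ is canonically self-$\hat\gamma$ if $(\hat\gamma,\iota)(G,\ell)=(G,\ell)$ in $\mathcal{G}_{or(n)}$. It is canonically self-dual, self-Petrial, self-Wilsonial if it is canonically self-$(g,g,\dots,g)$ with $g=\delta$, $g=\tau$, $g=\tau\delta\tau$ respectively, and canonically self-trial if this holds with $g=\delta\tau$ or $g=\tau\delta$.
   Formalization: The graph G is assumed connected and n ≥ 1: two disjoint twisted loops are canonically self-dual but, being disconnected, lie in no orbit of an OEB, and for n = 0 the trivial group has no element of order 2 or 3. *)

theory Defs
  imports "HOL-Algebra.Algebra"
begin

section \<open>Ribbon graphs as arrow presentations\<close>

text \<open>
  Ribbon graphs are given by their arrow presentations.  The arrows are directed segments with
  pairwise distinct end points, and an arrow is the pair (tail, head) of its end points.  Removing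
  the arrows from the circles that carry at least one of them leaves the complementary arcs, which
  pair up all the end points; \<open>arc\<close> sends an end point to the other end of its
  complementary arc.  Each such circle is thus a closed chain of alternating arrows and arcs.
  Circles without arrows (isolated vertices) carry no information, so only their number
  \<open>bare\<close> is recorded.
\<close>

type_synonym 'p edge_arrows = "('p \<times> 'p) \<times> ('p \<times> 'p)"

record ('e, 'p) arrow_presentation =
  edges :: "'e set"
  arrows :: "'e \<Rightarrow> 'p edge_arrows"
  arc :: "'p \<Rightarrow> 'p"
  bare :: nat

fun ends :: "'p edge_arrows \<Rightarrow> 'p set" where
  "ends ((t, h), (t', h')) = {t, h, t', h'}"

definition points :: "('e, 'p) arrow_presentation \<Rightarrow> 'p set" where
  "points G = (\<Union>e\<in>edges G. ends (arrows G e))"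

definition ribbon_graph :: "('e, 'p) arrow_presentation \<Rightarrow> bool" where
  "ribbon_graph G \<longleftrightarrow>
     finite (edges G) \<and>
     (\<forall>e\<in>edges G. card (ends (arrows G e)) = 4) \<and>
     (\<forall>e\<in>edges G. \<forall>f\<in>edges G. e \<noteq> f \<longrightarrow> ends (arrows G e) \<inter> ends (arrows G f) = {}) \<and>
     (\<forall>p\<in>points G. arc G p \<in> points G \<and> arc G p \<noteq> p \<and> arc G (arc G p) = p)"

text \<open>
  The order of the two arrows of an edge is immaterial, and reversing both of them amounts to
  choosing the other orientation of the boundary of the edge disc.
\<close>

fun edge_variants :: "'p edge_arrows \<Rightarrow> 'p edge_arrows set" where
  "edge_variants ((t, h), (t', h')) =
     {((t, h), (t', h')), ((t', h'), (t, h)), ((h, t), (h', t')), ((h', t'), (h, t))}"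

abbreviation map_edge :: "('p \<Rightarrow> 'q) \<Rightarrow> 'p edge_arrows \<Rightarrow> 'q edge_arrows" where
  "map_edge f \<equiv> map_prod (map_prod f f) (map_prod f f)"

text \<open>\<open>g\<close> is the bijection of edges induced by an isomorphism.\<close>

definition isomorphism_via ::
  "('e \<Rightarrow> 'f) \<Rightarrow> ('e, 'p) arrow_presentation \<Rightarrow> ('f, 'q) arrow_presentation \<Rightarrow> bool" where
  "isomorphism_via g G H \<longleftrightarrow>
     bij_betw g (edges G) (edges H) \<and> bare G = bare H \<and>
     (\<exists>f. bij_betw f (points G) (points H) \<and>
          (\<forall>p\<in>points G. f (arc G p) = arc H (f p)) \<and>
          (\<forall>e\<in>edges G. map_edge f (arrows G e) \<in> edge_variants (arrows H (g e))))"

subsection \<open>Vertices, components, orientability\<close>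

fun arrow_segments :: "'p edge_arrows \<Rightarrow> ('p \<times> 'p) set" where
  "arrow_segments (A, B) = {A, B}"

definition circle_segments :: "('e, 'p) arrow_presentation \<Rightarrow> ('p \<times> 'p) set" where
  "circle_segments G = (\<Union>e\<in>edges G. arrow_segments (arrows G e)) \<union> {(p, arc G p) | p. p \<in> points G}"

definition same_circle :: "('e, 'p) arrow_presentation \<Rightarrow> ('p \<times> 'p) set" where
  "same_circle G = (circle_segments G \<union> (circle_segments G)\<inverse>)\<^sup>*"

definition num_vertices :: "('e, 'p) arrow_presentation \<Rightarrow> nat" where
  "num_vertices G = card (points G // same_circle G) + bare G"

definition same_component :: "('e, 'p) arrow_presentation \<Rightarrow> ('p \<times> 'p) set" where
  "same_component G =
     (same_circle G \<union> (\<Union>e\<in>edges G. ends (arrows G e) \<times> ends (arrows G e)))\<^sup>*"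

definition num_components :: "('e, 'p) arrow_presentation \<Rightarrow> nat" where
  "num_components G = card (points G // same_component G) + bare G"

definition connected_rg :: "('e, 'p) arrow_presentation \<Rightarrow> bool" where
  "connected_rg G \<longleftrightarrow> num_components G = 1"

text \<open>
  Orientations of all the vertex discs: each circle is traversed in one of its two directions, and
  \<open>c p\<close> says that the end point \<open>p\<close> is where the traversal enters an
  arrow segment.  Along a circle, entry points and exit points of arrow segments alternate.
\<close>

fun alternates :: "('p \<Rightarrow> bool) \<Rightarrow> 'p edge_arrows \<Rightarrow> bool" where
  "alternates c ((t, h), (t', h')) \<longleftrightarrow> c t \<noteq> c h \<and> c t' \<noteq> c h'"

definition vertex_orientation :: "('e, 'p) arrow_presentation \<Rightarrow> ('p \<Rightarrow> bool) \<Rightarrow> bool" where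
  "vertex_orientation G c \<longleftrightarrow>
     (\<forall>e\<in>edges G. alternates c (arrows G e)) \<and> (\<forall>p\<in>points G. c (arc G p) \<noteq> c p)"

text \<open>
  A surface glued from discs along boundary segments is orientable iff the discs can be oriented
  so that on every common segment the two induced boundary directions are opposite.  The two
  arrows of an edge agree with an orientation of the boundary of the edge disc, so a suitable
  orientation of that disc exists iff the arrows both follow or both oppose the orientations of
  the vertices.
\<close>

fun coherent :: "('p \<Rightarrow> bool) \<Rightarrow> 'p edge_arrows \<Rightarrow> bool" where
  "coherent c ((t, h), (t', h')) \<longleftrightarrow> c t = c t'"

definition orientable_rg :: "('e, 'p) arrow_presentation \<Rightarrow> bool" where
  "orientable_rg G \<longleftrightarrow> (\<exists>c. vertex_orientation G c \<and> (\<forall>e\<in>edges G. coherent c (arrows G e)))"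

definition OEB :: "('e, 'p) arrow_presentation \<Rightarrow> bool" where
  "OEB G \<longleftrightarrow> ribbon_graph G \<and> num_vertices G = 1 \<and> orientable_rg G"


section \<open>The operations on one edge\<close>

datatype gen = Dual | Petrial

text \<open>
  The partial dual replaces the arrows \<open>A\<close>, \<open>B\<close> by arrows from the head of
  \<open>A\<close> to the tail of \<open>B\<close> and from the head of \<open>B\<close> to the tail
  of \<open>A\<close>; the complementary arcs stay.
\<close>

fun gen_edge :: "gen \<Rightarrow> 'p edge_arrows \<Rightarrow> 'p edge_arrows" where
  "gen_edge Dual ((t, h), (t', h')) = ((h, t'), (h', t))"
| "gen_edge Petrial ((t, h), (t', h')) = ((h, t), (t', h'))"

text \<open>
  The group presented by \<open>\<delta>\<close>, \<open>\<tau>\<close> with relators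
  \<open>\<delta>\<^sup>2\<close>, \<open>\<tau>\<^sup>2\<close>, \<open>(\<tau>\<delta>)\<^sup>3\<close>
  is taken to be the symmetric group on three letters.
\<close>

abbreviation twist_group :: "(nat \<Rightarrow> nat) monoid" where
  "twist_group \<equiv> sym_group 3"

definition delta :: "nat \<Rightarrow> nat" where "delta = transpose 1 2"

definition tau :: "nat \<Rightarrow> nat" where "tau = transpose 2 3"

fun gen_elt :: "gen \<Rightarrow> (nat \<Rightarrow> nat)" where
  "gen_elt Dual = delta"
| "gen_elt Petrial = tau"

definition word_elt :: "gen list \<Rightarrow> (nat \<Rightarrow> nat)" where
  "word_elt w = foldr (\<lambda>g s. gen_elt g \<otimes>\<^bsub>twist_group\<^esub> s) w \<one>\<^bsub>twist_group\<^esub>"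

definition word_edge :: "gen list \<Rightarrow> 'p edge_arrows \<Rightarrow> 'p edge_arrows" where
  "word_edge w = foldr gen_edge w"

text \<open>
  An element of the group acts through any word that represents it.  The choice of the word does
  not matter up to \<open>edge_variants\<close>; see \<open>word_edge_well_defined\<close> below.
\<close>

definition elt_edge :: "(nat \<Rightarrow> nat) \<Rightarrow> 'p edge_arrows \<Rightarrow> 'p edge_arrows" where
  "elt_edge s = word_edge (SOME w. word_elt w = s)"


section \<open>Ordered graphs and the action of the semidirect product\<close>

text \<open>
  Only the values of an ordering on \<open>{1..n}\<close> matter.  The set of isomorphism classes of
  ordered graphs with \<open>n\<close> edges is \<open>ordered_graphs n // ordered_iso n\<close>,
  and \<open>iso_class n (G, l)\<close> is its element represented by \<open>(G, l)\<close>.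
\<close>

type_synonym ('e, 'p) ordered_presentation = "('e, 'p) arrow_presentation \<times> (nat \<Rightarrow> 'e)"

definition ordered_graphs :: "nat \<Rightarrow> ('e, 'p) ordered_presentation set" where
  "ordered_graphs n =
     {(G, l). ribbon_graph G \<and> card (edges G) = n \<and> bij_betw l {1..n} (edges G)}"

definition ordered_iso :: "nat \<Rightarrow> ('e, 'p) ordered_presentation rel" where
  "ordered_iso n =
     {((G, l), (H, m)). (G, l) \<in> ordered_graphs n \<and> (H, m) \<in> ordered_graphs n \<and>
        (\<exists>g. isomorphism_via g G H \<and> (\<forall>i\<in>{1..n}. g (l i) = m i))}"

definition iso_class :: "nat \<Rightarrow> ('e, 'p) ordered_presentation \<Rightarrow> ('e, 'p) ordered_presentation set"
  where "iso_class n Gl = ordered_iso n `` {Gl}"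

abbreviation twist_power :: "nat \<Rightarrow> (nat \<Rightarrow> nat \<Rightarrow> nat) monoid" where
  "twist_power n \<equiv> product_group {1..n} (\<lambda>_. twist_group)"

definition twuality_group :: "nat \<Rightarrow> ((nat \<Rightarrow> nat \<Rightarrow> nat) \<times> (nat \<Rightarrow> nat)) monoid" where
  "twuality_group n =
     \<lparr>carrier = carrier (twist_power n) \<times> carrier (sym_group n),
      monoid.mult = (\<lambda>(\<gamma>1, \<pi>1) (\<gamma>2, \<pi>2).
                (\<gamma>1 \<otimes>\<^bsub>twist_power n\<^esub> (\<gamma>2 \<circ> inv\<^bsub>sym_group n\<^esub> \<pi>1), \<pi>1 \<otimes>\<^bsub>sym_group n\<^esub> \<pi>2)),
      one = (\<one>\<^bsub>twist_power n\<^esub>, \<one>\<^bsub>sym_group n\<^esub>)\<rparr>"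

definition Gamma ::
  "nat \<Rightarrow> (nat \<Rightarrow> nat \<Rightarrow> nat) \<Rightarrow> (nat \<Rightarrow> 'e) \<Rightarrow> ('e, 'p) arrow_presentation \<Rightarrow> ('e, 'p) arrow_presentation"
  where
  "Gamma n \<gamma> l G =
     G\<lparr>arrows := (\<lambda>e. if e \<in> edges G then elt_edge (\<gamma> (inv_into {1..n} l e)) (arrows G e)
                     else arrows G e)\<rparr>"

definition act_rep ::
  "nat \<Rightarrow> (nat \<Rightarrow> nat \<Rightarrow> nat) \<times> (nat \<Rightarrow> nat) \<Rightarrow> ('e, 'p) ordered_presentation \<Rightarrow> ('e, 'p) ordered_presentation"
  where
  "act_rep n = (\<lambda>(\<gamma>, \<pi>) (G, l).
     (let l' = l \<circ> inv\<^bsub>sym_group n\<^esub> \<pi> in (Gamma n \<gamma> l' G, l')))"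

text \<open>The induced action on isomorphism classes; see \<open>act_iso_class\<close> below.\<close>

definition act ::
  "nat \<Rightarrow> (nat \<Rightarrow> nat \<Rightarrow> nat) \<times> (nat \<Rightarrow> nat)
    \<Rightarrow> ('e, 'p) ordered_presentation set \<Rightarrow> ('e, 'p) ordered_presentation set" where
  "act n a C = (\<Union>Gl\<in>C. iso_class n (act_rep n a Gl))"

definition Orb :: "nat \<Rightarrow> ('e, 'p) ordered_presentation \<Rightarrow> ('e, 'p) ordered_presentation set set" where
  "Orb n Gl = orbit (twuality_group n) (act n) (iso_class n Gl)"

definition canonically_self ::
  "nat \<Rightarrow> (nat \<Rightarrow> nat \<Rightarrow> nat) \<Rightarrow> ('e, 'p) ordered_presentation \<Rightarrow> bool" where
  "canonically_self n \<gamma> Gl \<longleftrightarrow> act n (\<gamma>, \<one>\<^bsub>sym_group n\<^esub>) (iso_class n Gl) = iso_class n Gl"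

abbreviation constant_twist :: "nat \<Rightarrow> (nat \<Rightarrow> nat) \<Rightarrow> nat \<Rightarrow> nat \<Rightarrow> nat" where
  "constant_twist n s \<equiv> (\<lambda>i\<in>{1..n}. s)"

definition canonically_self_dual :: "nat \<Rightarrow> ('e, 'p) ordered_presentation \<Rightarrow> bool" where
  "canonically_self_dual n Gl \<longleftrightarrow> canonically_self n (constant_twist n delta) Gl"

definition canonically_self_Petrial :: "nat \<Rightarrow> ('e, 'p) ordered_presentation \<Rightarrow> bool" where
  "canonically_self_Petrial n Gl \<longleftrightarrow> canonically_self n (constant_twist n tau) Gl"

definition canonically_self_Wilsonial :: "nat \<Rightarrow> ('e, 'p) ordered_presentation \<Rightarrow> bool" where
  "canonically_self_Wilsonial n Gl \<longleftrightarrow>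
     canonically_self n (constant_twist n (tau \<otimes>\<^bsub>twist_group\<^esub> delta \<otimes>\<^bsub>twist_group\<^esub> tau)) Gl"

definition canonically_self_trial :: "nat \<Rightarrow> ('e, 'p) ordered_presentation \<Rightarrow> bool" where
  "canonically_self_trial n Gl \<longleftrightarrow>
     canonically_self n (constant_twist n (delta \<otimes>\<^bsub>twist_group\<^esub> tau)) Gl \<or>
     canonically_self n (constant_twist n (tau \<otimes>\<^bsub>twist_group\<^esub> delta)) Gl"


section \<open>Well-definedness\<close>

lemma delta_carrier: "delta \<in> carrier twist_group"
  and tau_carrier: "tau \<in> carrier twist_group"
  by (simp_all add: sym_group_carrier delta_def tau_def permutes_swap_id)

lemma twist_relations:
  "delta \<circ> delta = id" "tau \<circ> tau = id"
  "(tau \<circ> delta) \<circ> (tau \<circ> delta) \<circ> (tau \<circ> delta) = id"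
  by (auto simp: delta_def tau_def transpose_def fun_eq_iff)

lemma edge_variants_refl: "x \<in> edge_variants x"
  by (cases x rule: edge_variants.cases) simp

lemma edge_variants_sym: "x \<in> edge_variants y \<Longrightarrow> y \<in> edge_variants x"
  by (cases x rule: edge_variants.cases; cases y rule: edge_variants.cases) auto

lemma edge_variants_trans:
  "x \<in> edge_variants y \<Longrightarrow> y \<in> edge_variants z \<Longrightarrow> x \<in> edge_variants z"
  by (cases x rule: edge_variants.cases; cases y rule: edge_variants.cases;
      cases z rule: edge_variants.cases) auto

lemma gen_edge_variants: "x \<in> edge_variants y \<Longrightarrow> gen_edge g x \<in> edge_variants (gen_edge g y)"
  by (cases x rule: edge_variants.cases; cases y rule: edge_variants.cases; cases g) auto

lemma map_edge_gen_edge: "map_edge f (gen_edge g x) = gen_edge g (map_edge f x)"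
  by (cases x rule: edge_variants.cases; cases g) auto

lemma map_edge_variants: "x \<in> edge_variants y \<Longrightarrow> map_edge f x \<in> edge_variants (map_edge f y)"
  by (cases x rule: edge_variants.cases; cases y rule: edge_variants.cases) auto

lemma ends_gen_edge: "ends (gen_edge g x) = ends x"
  by (cases x rule: edge_variants.cases; cases g) auto

lemma word_edge_simps [simp]:
  "word_edge [] x = x" "word_edge (g # w) x = gen_edge g (word_edge w x)"
  by (simp_all add: word_edge_def)

lemma word_elt_simps [simp]:
  "word_elt [] = id" "word_elt (g # w) = gen_elt g \<circ> word_elt w"
  by (simp_all add: word_elt_def sym_group_def)

lemma word_edge_variants: "x \<in> edge_variants y \<Longrightarrow> word_edge w x \<in> edge_variants (word_edge w y)"
  by (induction w) (auto intro: gen_edge_variants)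

lemma map_edge_word_edge: "map_edge f (word_edge w x) = word_edge w (map_edge f x)"
  by (induction w) (auto simp: map_edge_gen_edge)

lemma ends_word_edge: "ends (word_edge w x) = ends x"
  by (induction w) (auto simp: ends_gen_edge)

definition normal_words :: "gen list set" where
  "normal_words =
     {[], [Dual], [Petrial], [Dual, Petrial], [Petrial, Dual], [Petrial, Dual, Petrial]}"

lemma normal_word_step:
  assumes "v \<in> normal_words"
  shows "\<exists>u\<in>normal_words. word_elt u = word_elt (g # v) \<and>
           (\<forall>x :: 'p edge_arrows. word_edge (g # v) x \<in> edge_variants (word_edge u x))"
proof -
  have *: "delta \<circ> (tau \<circ> (delta \<circ> tau)) = tau \<circ> delta"
          "delta \<circ> (tau \<circ> delta) = tau \<circ> (delta \<circ> tau)"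
          "delta \<circ> delta = id" "tau \<circ> tau = id" "tau \<circ> (tau \<circ> (delta \<circ> tau)) = delta \<circ> tau"
          "delta \<circ> (delta \<circ> tau) = tau" "tau \<circ> (tau \<circ> delta) = delta"
    by (auto simp: delta_def tau_def transpose_def fun_eq_iff)
  have step: "?thesis" if "u \<in> normal_words" "word_elt u = word_elt (g # v)"
    "\<And>x :: 'p edge_arrows. word_edge (g # v) x \<in> edge_variants (word_edge u x)" for u
    using that by (intro bexI[of _ u] conjI allI)
  consider "v = []" | "v = [Dual]" | "v = [Petrial]" | "v = [Dual, Petrial]"
    | "v = [Petrial, Dual]" | "v = [Petrial, Dual, Petrial]"
    using assms by (auto simp: normal_words_def)
  then show ?thesis
  proof cases
    case 1 then show ?thesis
      by (intro step[of "[g]"]; cases g; auto simp: normal_words_def edge_variants_refl)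
  next
    case 2 then show ?thesis
      by (intro step[of "if g = Dual then [] else [Petrial, Dual]"]; cases g)
         (auto simp: normal_words_def edge_variants_refl * )
  next
    case 3 then show ?thesis
      by (intro step[of "if g = Dual then [Dual, Petrial] else []"]; cases g)
         (auto simp: normal_words_def edge_variants_refl * )
  next
    case 4 then show ?thesis
      by (intro step[of "if g = Dual then [Petrial] else [Petrial, Dual, Petrial]"]; cases g)
         (auto simp: normal_words_def edge_variants_refl * )
  next
    case 5 then show ?thesis
      by (intro step[of "if g = Dual then [Petrial, Dual, Petrial] else [Dual]"]; cases g)
         (auto simp: normal_words_def edge_variants_refl * )
  next
    case 6 then show ?thesis
      by (intro step[of "if g = Dual then [Petrial, Dual] else [Dual, Petrial]"]; cases g)
         (auto simp: normal_words_def edge_variants_refl * )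
  qed
qed

lemma normal_word_exists:
  "\<exists>u\<in>normal_words. word_elt u = word_elt w \<and>
     (\<forall>x :: 'p edge_arrows. word_edge w x \<in> edge_variants (word_edge u x))"
proof (induction w)
  case Nil
  show ?case by (intro bexI[of _ "[]"]) (auto simp: normal_words_def edge_variants_refl)
next
  case (Cons g w)
  then obtain v where v: "v \<in> normal_words" "word_elt v = word_elt w"
    "\<And>x :: 'p edge_arrows. word_edge w x \<in> edge_variants (word_edge v x)" by blast
  from normal_word_step[OF v(1), of g] obtain u where u: "u \<in> normal_words"
    "word_elt u = word_elt (g # v)"
    "\<And>x :: 'p edge_arrows. word_edge (g # v) x \<in> edge_variants (word_edge u x)" by blast
  have "word_edge (g # w) x \<in> edge_variants (word_edge u x)" for x :: "'p edge_arrows"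
    using edge_variants_trans[OF gen_edge_variants[OF v(3)]] u(3)[of x] by simp
  then show ?case using u(1,2) v(2) by (intro bexI[of _ u] conjI allI) simp_all
qed

lemma normal_word_unique:
  assumes "u \<in> normal_words" "v \<in> normal_words" "word_elt u = word_elt v"
  shows "u = v"
proof -
  have "word_elt u 1 = word_elt v 1" "word_elt u 2 = word_elt v 2" using assms(3) by simp_all
  with assms(1,2) show ?thesis
    unfolding normal_words_def by (auto simp: delta_def tau_def transpose_def)
qed

lemma word_edge_well_defined:
  assumes "word_elt w = word_elt w'"
  shows "word_edge w x \<in> edge_variants (word_edge w' x)"
proof -
  obtain u where u: "u \<in> normal_words" "word_elt u = word_elt w"
    "\<And>x::'a edge_arrows. word_edge w x \<in> edge_variants (word_edge u x)"
    using normal_word_exists[of w] by blast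
  obtain v where v: "v \<in> normal_words" "word_elt v = word_elt w'"
    "\<And>x::'a edge_arrows. word_edge w' x \<in> edge_variants (word_edge v x)"
    using normal_word_exists[of w'] by blast
  have "u = v" using normal_word_unique u v assms by metis
  then show ?thesis using u(3) v(3) edge_variants_sym edge_variants_trans by metis
qed

lemma word_elt_surj: "s \<in> carrier twist_group \<Longrightarrow> \<exists>w. word_elt w = s"
proof -
  assume s: "s \<in> carrier twist_group"
  have sub: "word_elt ` normal_words \<subseteq> carrier twist_group"
    using delta_carrier tau_carrier
    by (auto simp: normal_words_def sym_group_carrier permutes_id
             intro!: permutes_compose)
  have "card (word_elt ` normal_words) = card normal_words"
    by (intro card_image inj_onI normal_word_unique)
  also have "\<dots> = 6" by (simp add: normal_words_def)
  also have "\<dots> = card (carrier twist_group)"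
    by (simp add: sym_group_card_carrier fact_numeral)
  finally have "word_elt ` normal_words = carrier twist_group"
    using sub by (intro card_subset_eq) (auto simp: sym_group_def finite_permutations)
  then have "s \<in> word_elt ` normal_words" using s by simp
  then show ?thesis by (metis imageE)
qed


lemma elt_edge_word:
  assumes "s \<in> carrier twist_group"
  obtains w where "word_elt w = s" "elt_edge s = word_edge w"
  using someI_ex[OF word_elt_surj[OF assms]] unfolding elt_edge_def by blast

lemma map_edge_id: "(\<And>p. p \<in> ends x \<Longrightarrow> f p = p) \<Longrightarrow> map_edge f x = x"
  by (cases x rule: ends.cases) auto

lemma map_edge_comp: "map_edge f (map_edge g x) = map_edge (f \<circ> g) x"
  by (cases x rule: ends.cases) auto

lemma ends_subset_points: "e \<in> edges G \<Longrightarrow> ends (arrows G e) \<subseteq> points G"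
  by (auto simp: points_def)

lemma isomorphism_via_id: "isomorphism_via id G G"
  unfolding isomorphism_via_def
  by (auto intro!: exI[of _ id] simp: edge_variants_refl prod.map_id0)

lemma isomorphism_via_trans:
  assumes "isomorphism_via g G H" "isomorphism_via g' H K"
  shows "isomorphism_via (g' \<circ> g) G K"
proof -
  from assms obtain f f' where g: "bij_betw g (edges G) (edges H)" "bij_betw g' (edges H) (edges K)"
    and f: "bij_betw f (points G) (points H)" "bij_betw f' (points H) (points K)"
    and arc: "\<And>p. p \<in> points G \<Longrightarrow> f (arc G p) = arc H (f p)"
      "\<And>p. p \<in> points H \<Longrightarrow> f' (arc H p) = arc K (f' p)"
    and arr: "\<And>e. e \<in> edges G \<Longrightarrow> map_edge f (arrows G e) \<in> edge_variants (arrows H (g e))"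
      "\<And>e. e \<in> edges H \<Longrightarrow> map_edge f' (arrows H e) \<in> edge_variants (arrows K (g' e))"
    and b: "bare G = bare H" "bare H = bare K"
    unfolding isomorphism_via_def by blast
  have "map_edge (f' \<circ> f) (arrows G e) \<in> edge_variants (arrows K ((g' \<circ> g) e))"
    if e: "e \<in> edges G" for e
  proof -
    have ge: "g e \<in> edges H" using g(1) e by (auto simp: bij_betw_def)
    show ?thesis
      using edge_variants_trans[OF map_edge_variants[OF arr(1)[OF e]] arr(2)[OF ge]]
      by (simp add: map_edge_comp)
  qed
  moreover have "(f' \<circ> f) (arc G p) = arc K ((f' \<circ> f) p)" if "p \<in> points G" for p
    using that arc f(1) by (auto simp: bij_betw_def)
  moreover have "bij_betw (f' \<circ> f) (points G) (points K)" "bij_betw (g' \<circ> g) (edges G) (edges K)"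
    using f g by (auto intro: bij_betw_trans)
  ultimately show ?thesis
    unfolding isomorphism_via_def using b by metis
qed

lemma isomorphism_via_sym:
  assumes "isomorphism_via g G H" and "ribbon_graph G"
  shows "isomorphism_via (inv_into (edges G) g) H G"
proof -
  from assms obtain f where g: "bij_betw g (edges G) (edges H)"
    and f: "bij_betw f (points G) (points H)"
    and arc: "\<And>p. p \<in> points G \<Longrightarrow> f (arc G p) = arc H (f p)"
    and arr: "\<And>e. e \<in> edges G \<Longrightarrow> map_edge f (arrows G e) \<in> edge_variants (arrows H (g e))"
    and b: "bare G = bare H"
    unfolding isomorphism_via_def by blast
  let ?g = "inv_into (edges G) g" and ?f = "inv_into (points G) f"
  have ff: "?f (f p) = p" if "p \<in> points G" for p
    using f that by (auto simp: bij_betw_def)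
  have "map_edge ?f (arrows H e) \<in> edge_variants (arrows G (?g e))" if e: "e \<in> edges H" for e
  proof -
    have ge: "?g e \<in> edges G" "g (?g e) = e"
      using g e by (auto simp: bij_betw_def inv_into_into f_inv_into_f)
    have "map_edge ?f (map_edge f (arrows G (?g e))) = arrows G (?g e)"
      unfolding map_edge_comp
      by (rule map_edge_id) (use ff ends_subset_points[OF ge(1)] in auto)
    then show ?thesis
      using edge_variants_sym[OF map_edge_variants[OF arr[OF ge(1)], of ?f]] ge(2) by simp
  qed
  moreover have "?f (arc H p) = arc G (?f p)" if p: "p \<in> points H" for p
  proof -
    obtain q where q: "q \<in> points G" "p = f q" using f p by (auto simp: bij_betw_def)
    have "arc G q \<in> points G" using assms(2) q(1) by (auto simp: ribbon_graph_def)
    then show ?thesis using arc[OF q(1)] q ff by metis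
  qed
  moreover have "bij_betw ?f (points H) (points G)" "bij_betw ?g (edges H) (edges G)"
    using f g by (auto intro: bij_betw_inv_into)
  ultimately show ?thesis
    unfolding isomorphism_via_def using b by metis
qed

lemma equiv_ordered_iso:
  "equiv (ordered_graphs n :: ('e, 'p) ordered_presentation set) (ordered_iso n)"
proof (rule equivI)
  let ?r = "ordered_iso n :: ('e, 'p) ordered_presentation rel"
  show "?r \<subseteq> ordered_graphs n \<times> ordered_graphs n"
    by (auto simp: ordered_iso_def)
  show "refl_on (ordered_graphs n) ?r"
    by (auto simp: refl_on_def ordered_iso_def intro!: exI[of _ id] isomorphism_via_id)
  show "sym ?r"
  proof (rule symI)
    fix Gl Hm :: "('e, 'p) ordered_presentation"
    assume a: "(Gl, Hm) \<in> ordered_iso n"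
    obtain G l H m where [simp]: "Gl = (G, l)" "Hm = (H, m)" by (metis surj_pair)
    from a obtain g where iso: "isomorphism_via g G H" and gl: "\<And>i. i \<in> {1..n} \<Longrightarrow> g (l i) = m i"
      by (auto simp: ordered_iso_def)
    have r: "ribbon_graph G" and l: "bij_betw l {1..n} (edges G)"
      using a by (auto simp: ordered_iso_def ordered_graphs_def)
    have g: "bij_betw g (edges G) (edges H)"
      using iso by (auto simp: isomorphism_via_def)
    have "inv_into (edges G) g (m i) = l i" if i: "i \<in> {1..n}" for i
    proof -
      have "l i \<in> edges G" using l i by (rule bij_betw_apply)
      then show ?thesis using gl[OF i] g by (metis bij_betw_inv_into_left)
    qed
    then show "(Hm, Gl) \<in> ordered_iso n"
      using isomorphism_via_sym[OF iso r] a unfolding ordered_iso_def by auto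
  qed
  show "trans ?r"
  proof (rule transI)
    fix Gl Hm Kk :: "('e, 'p) ordered_presentation"
    assume a: "(Gl, Hm) \<in> ordered_iso n" "(Hm, Kk) \<in> ordered_iso n"
    obtain G l H m K k where [simp]: "Gl = (G, l)" "Hm = (H, m)" "Kk = (K, k)"
      by (metis surj_pair)
    from a obtain g g' where "isomorphism_via g G H" "\<And>i. i \<in> {1..n} \<Longrightarrow> g (l i) = m i"
      and "isomorphism_via g' H K" "\<And>i. i \<in> {1..n} \<Longrightarrow> g' (m i) = k i"
      by (auto simp: ordered_iso_def)
    then have "isomorphism_via (g' \<circ> g) G K \<and> (\<forall>i\<in>{1..n}. (g' \<circ> g) (l i) = k i)"
      by (auto intro: isomorphism_via_trans)
    then show "(Gl, Kk) \<in> ordered_iso n"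
      using a unfolding ordered_iso_def by auto
  qed
qed

lemma ends_elt_edge: "s \<in> carrier twist_group \<Longrightarrow> ends (elt_edge s x) = ends x"
  by (metis elt_edge_word ends_word_edge)

lemma elt_edge_isomorphism:
  assumes "s \<in> carrier twist_group" "map_edge f x \<in> edge_variants y"
  shows "map_edge f (elt_edge s x) \<in> edge_variants (elt_edge s y)"
proof -
  obtain w where w: "word_elt w = s" "elt_edge s x = word_edge w x"
    using elt_edge_word[OF assms(1)] by metis
  obtain v where v: "word_elt v = s" "elt_edge s y = word_edge v y"
    using elt_edge_word[OF assms(1)] by metis
  have "word_edge w (map_edge f x) \<in> edge_variants (word_edge w y)"
    by (rule word_edge_variants[OF assms(2)])
  moreover have "word_edge w y \<in> edge_variants (word_edge v y)"
    by (rule word_edge_well_defined) (simp add: w v)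
  ultimately show ?thesis
    unfolding w v map_edge_word_edge by (rule edge_variants_trans)
qed

lemma act_rep_closed:
  assumes "a \<in> carrier (twuality_group n)" "Gl \<in> ordered_graphs n"
  shows "act_rep n a Gl \<in> ordered_graphs n"
proof -
  obtain \<gamma> \<pi> G l where [simp]: "a = (\<gamma>, \<pi>)" "Gl = (G, l)" by (metis surj_pair)
  have \<gamma>: "\<And>i. i \<in> {1..n} \<Longrightarrow> \<gamma> i \<in> carrier twist_group" and \<pi>: "\<pi> \<in> carrier (sym_group n)"
    using assms(1) by (auto simp: twuality_group_def)
  have G: "ribbon_graph G" "card (edges G) = n" "bij_betw l {1..n} (edges G)"
    using assms(2) by (auto simp: ordered_graphs_def)
  let ?l = "l \<circ> inv\<^bsub>sym_group n\<^esub> \<pi>"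
  have "inv\<^bsub>sym_group n\<^esub> \<pi> \<in> carrier (sym_group n)"
    using \<pi> by (rule group.inv_closed[OF sym_group_is_group])
  then have l: "bij_betw ?l {1..n} (edges G)"
    using G(3) by (auto simp: sym_group_carrier intro: bij_betw_trans permutes_imp_bij)
  have e: "edges (Gamma n \<gamma> ?l G) = edges G" "arc (Gamma n \<gamma> ?l G) = arc G"
    by (auto simp: Gamma_def)
  have en: "ends (arrows (Gamma n \<gamma> ?l G) e) = ends (arrows G e)" if "e \<in> edges G" for e
  proof -
    have "inv_into {1..n} ?l e \<in> {1..n}"
      using l that by (metis bij_betw_def inv_into_into)
    then show ?thesis using that \<gamma> by (simp add: Gamma_def ends_elt_edge)
  qed
  have "points (Gamma n \<gamma> ?l G) = points G"
    using en e by (auto simp: points_def)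
  then have "ribbon_graph (Gamma n \<gamma> ?l G)"
    using G(1) en e by (simp add: ribbon_graph_def)
  then show ?thesis using l G e by (simp add: act_rep_def ordered_graphs_def Let_def)
qed

lemma act_rep_iso:
  assumes "a \<in> carrier (twuality_group n)" "(Gl, Hm) \<in> ordered_iso n"
  shows "(act_rep n a Gl, act_rep n a Hm) \<in> ordered_iso n"
proof -
  obtain \<gamma> \<pi> G l H m where [simp]: "a = (\<gamma>, \<pi>)" "Gl = (G, l)" "Hm = (H, m)" by (metis surj_pair)
  have \<gamma>: "\<And>i. i \<in> {1..n} \<Longrightarrow> \<gamma> i \<in> carrier twist_group" and \<pi>: "\<pi> \<in> carrier (sym_group n)"
    using assms(1) by (auto simp: twuality_group_def)
  have GH: "(G, l) \<in> ordered_graphs n" "(H, m) \<in> ordered_graphs n"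
    using assms(2) by (auto simp: ordered_iso_def)
  obtain g where iso: "isomorphism_via g G H" and gl: "\<And>i. i \<in> {1..n} \<Longrightarrow> g (l i) = m i"
    using assms(2) by (auto simp: ordered_iso_def)
  define l' m' where "l' = l \<circ> inv\<^bsub>sym_group n\<^esub> \<pi>" and "m' = m \<circ> inv\<^bsub>sym_group n\<^esub> \<pi>"
  have inv: "inv\<^bsub>sym_group n\<^esub> \<pi> permutes {1..n}"
    using group.inv_closed[OF sym_group_is_group \<pi>] by (simp add: sym_group_carrier)
  then have bij: "bij_betw l' {1..n} (edges G)" "bij_betw m' {1..n} (edges H)"
    using GH unfolding l'_def m'_def ordered_graphs_def
    by (auto intro: bij_betw_trans permutes_imp_bij)
  have gl': "g (l' i) = m' i" if "i \<in> {1..n}" for i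
    unfolding l'_def m'_def comp_def by (rule gl) (use permutes_in_image[OF inv] that in blast)
  from iso obtain f where g: "bij_betw g (edges G) (edges H)"
    and f: "bij_betw f (points G) (points H)"
    and arc: "\<And>p. p \<in> points G \<Longrightarrow> f (arc G p) = arc H (f p)"
    and arr: "\<And>e. e \<in> edges G \<Longrightarrow> map_edge f (arrows G e) \<in> edge_variants (arrows H (g e))"
    and b: "bare G = bare H"
    unfolding isomorphism_via_def by blast
  let ?G = "Gamma n \<gamma> l' G" and ?H = "Gamma n \<gamma> m' H"
  have idx: "inv_into {1..n} l' e \<in> {1..n}" "inv_into {1..n} m' (g e) = inv_into {1..n} l' e"
    and ge: "g e \<in> edges H" if "e \<in> edges G" for e
  proof -
    have "e \<in> l' ` {1..n}" using bij(1) that by (simp add: bij_betw_def)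
    then obtain i where i: "i \<in> {1..n}" "e = l' i" by blast
    show "inv_into {1..n} l' e \<in> {1..n}" "inv_into {1..n} m' (g e) = inv_into {1..n} l' e"
      using i bij gl' by (auto simp: bij_betw_def inv_into_f_f)
    show "g e \<in> edges H" using g that by (auto simp: bij_betw_def)
  qed
  have ends': "points ?G = points G" "points ?H = points H"
  proof -
    have "inv_into {1..n} m' e \<in> {1..n}" if "e \<in> edges H" for e
      using bij(2) that by (metis bij_betw_def inv_into_into)
    then show "points ?H = points H"
      using \<gamma> by (simp add: points_def Gamma_def ends_elt_edge)
    show "points ?G = points G"
      using \<gamma> idx(1) by (simp add: points_def Gamma_def ends_elt_edge)
  qed
  have "map_edge f (arrows ?G e) \<in> edge_variants (arrows ?H (g e))" if "e \<in> edges G" for e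
    using elt_edge_isomorphism[OF \<gamma>[OF idx(1)[OF that]] arr[OF that]] idx[OF that] ge[OF that] that
    by (simp add: Gamma_def)
  moreover have "edges ?G = edges G" "edges ?H = edges H" "arc ?G = arc G" "arc ?H = arc H"
    "bare ?G = bare G" "bare ?H = bare H"
    by (auto simp: Gamma_def)
  ultimately have "isomorphism_via g ?G ?H"
    unfolding isomorphism_via_def using ends' f g arc b by metis
  moreover have "(?G, l') \<in> ordered_graphs n" "(?H, m') \<in> ordered_graphs n"
    using act_rep_closed[OF assms(1)] GH by (auto simp: act_rep_def l'_def m'_def Let_def)
  ultimately show ?thesis
    using gl' by (auto simp: act_rep_def ordered_iso_def l'_def m'_def Let_def)
qed

lemma act_iso_class:
  assumes "a \<in> carrier (twuality_group n)" "Gl \<in> ordered_graphs n"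
  shows "act n a (iso_class n Gl) = iso_class n (act_rep n a Gl)"
proof -
  have "iso_class n (act_rep n a Hm) = iso_class n (act_rep n a Gl)" if "Hm \<in> iso_class n Gl" for Hm
    using that act_rep_iso[OF assms(1), of Gl Hm] unfolding iso_class_def
    by (metis Image_singleton_iff equiv_class_eq[OF equiv_ordered_iso])
  moreover have "Gl \<in> iso_class n Gl"
    using assms(2) unfolding iso_class_def by (rule equiv_class_self[OF equiv_ordered_iso])
  ultimately show ?thesis unfolding act_def by blast
qed

end

theory Submission
  imports Defs
begin

text \<open>
  Two observations carry the proof.

  First, the twuality group acts, so if \<open>u\<close> fixes an ordered graph then
  \<open>\<alpha> u \<alpha>\<^sup>-\<^sup>1\<close> fixes its image under \<open>\<alpha>\<close>
  (\<open>act_conjugate\<close>), and conjugation preserves orders (\<open>ord_conjugate\<close>).  A constant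
  twist by \<open>\<delta>\<close>, \<open>\<tau>\<close> or \<open>\<tau>\<delta>\<tau>\<close> has order 2, one by
  \<open>\<delta>\<tau>\<close> or \<open>\<tau>\<delta>\<close> has order 3.  Hence any OEB in the orbit of the
  given graph, reached by twists alone, is self-twual under a twist of the right order.

  Second, every connected graph with an edge has such an OEB in its orbit
  (\<open>exists_OEB_twual\<close>).  The partial dual at an edge that joins two different vertices merges
  the two vertex circles (\<open>dual_merges_circles\<close>).  A choice of twists that puts as many pairs
  of end points as possible on common circles therefore makes every edge a loop
  (\<open>exists_twual_of_loops\<close>), and a connected graph all of whose edges are loops has only one
  vertex.  Its single circle can be traversed in a direction (\<open>orientation_of_bouquet\<close>), and a
  partial Petrial at each loop whose arrows disagree with that direction makes the bouquet orientable
  without changing the circle.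

  Circles are handled through two fixed-point free involutions on the end points: \<open>arc\<close>, and the
  map \<open>mate\<close> to the other end of the same arrow.  A circle is an orbit of the dihedral group that
  they generate; the two facts about circles that are needed are a parity count and an alternating
  two-colouring.

  To avoid the arbitrary choice of words in \<open>elt_edge\<close>, twists are carried out by explicit words
  (\<open>retwist\<close>); these compose on the nose, while group elements compose only up to isomorphism.
\<close>

section \<open>Pairs of fixed-point free involutions\<close>

definition pairing :: "'a set \<Rightarrow> ('a \<Rightarrow> 'a) \<Rightarrow> bool" where
  "pairing P a \<longleftrightarrow> (\<forall>p\<in>P. a p \<in> P \<and> a p \<noteq> p \<and> a (a p) = p)"

lemma pairingD:
  assumes "pairing P a" "p \<in> P"
  shows "a p \<in> P" "a p \<noteq> p" "a (a p) = p"
  using assms by (auto simp: pairing_def)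

lemma even_card_pairing:
  assumes "finite S" "pairing S a"
  shows "even (card S)"
  using assms
proof (induction S rule: finite_psubset_induct)
  case (psubset S)
  show ?case
  proof (cases "S = {}")
    case False
    then obtain p where p: "p \<in> S" by blast
    note a = pairingD[OF psubset.prems]
    let ?T = "S - {p, a p}"
    have "pairing ?T a"
      unfolding pairing_def using a p by auto metis+
    then have "even (card ?T)" using p by (intro psubset.IH) auto
    moreover have "card S = card (?T \<union> {p, a p})"
      using a(1)[OF p] p by (intro arg_cong[of _ _ card]) blast
    then have "card S = card ?T + card {p, a p}"
      using psubset.hyps by (subst card_Un_disjoint[symmetric]) auto
    ultimately show ?thesis using a(2)[OF p] by (simp add: eq_commute)
  qed simp
qed

text \<open>
  A word of odd length in two involutions is conjugate to one of them.  An equation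
  \<open>(a b)\<^sup>k p = a p\<close> would say that such a word, hence \<open>a\<close> or \<open>b\<close>, has a fixed point.
  The induction strips two letters from each end of the word and replaces \<open>p\<close> by \<open>a b p\<close>.
\<close>

lemma alternating_walk_avoids_partner:
  assumes a: "pairing P a" and b: "pairing P b" and "p \<in> P"
  shows "((a \<circ> b) ^^ k) p \<noteq> a p"
  using \<open>p \<in> P\<close>
proof (induction k arbitrary: p rule: induct_nat_012)
  case 0
  then show ?case using pairingD(2)[OF a, of p] by simp
next
  case 1
  have "a (a (b p)) = b p" "a (a p) = p" "b p \<noteq> p"
    using 1 pairingD[OF a] pairingD[OF b] by simp_all
  then have "a (b p) \<noteq> a p" by metis
  then show ?case by simp
next
  case (ge2 k)
  let ?r = "a \<circ> b"
  have q: "?r p \<in> P" using ge2.prems pairingD(1)[OF a] pairingD(1)[OF b] by simp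
  have walk: "(?r ^^ k) (?r p) \<in> P"
    using q by (induction k) (simp_all add: pairingD(1)[OF a] pairingD(1)[OF b])
  show ?case
  proof
    assume *: "(?r ^^ Suc (Suc k)) p = a p"
    have "(?r ^^ Suc (Suc k)) p = ?r ((?r ^^ k) (?r p))"
      by (metis comp_apply funpow.simps(2) funpow_swap1)
    then have "a (b ((?r ^^ k) (?r p))) = a p"
      using * by (simp only: comp_apply)
    then have "b (a (a (b ((?r ^^ k) (?r p))))) = b (a (a p))" by simp
    then have "(?r ^^ k) (?r p) = b p"
      using walk ge2.prems pairingD[OF a] pairingD[OF b] by metis
    also have "b p = a (?r p)"
      using ge2.prems pairingD[OF a] pairingD[OF b] by simp
    finally show False using ge2.IH(1)[OF q] by (rule notE[rotated])
  qed
qed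

text \<open>
  The dihedral group generated by the two involutions is transitive on \<open>P\<close>; its rotation subgroup,
  generated by \<open>a \<circ> b\<close>, has two orbits, which the involutions exchange.  They are the colour classes.
\<close>

lemma alternating_colouring:
  assumes fin: "finite P" and a: "pairing P a" and b: "pairing P b"
    and one: "\<And>S. S \<subseteq> P \<Longrightarrow> S \<noteq> {} \<Longrightarrow> a ` S \<subseteq> S \<Longrightarrow> b ` S \<subseteq> S \<Longrightarrow> S = P"
  shows "\<exists>c :: 'a \<Rightarrow> bool. \<forall>p\<in>P. c (a p) \<noteq> c p \<and> c (b p) \<noteq> c p"
proof (cases "P = {}")
  case False
  note ab = pairingD[OF a] pairingD[OF b]
  from False obtain p0 where p0: "p0 \<in> P" by blast
  define r where "r = a \<circ> b"
  define W where "W = range (\<lambda>k. (r ^^ k) p0)"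
  have WP: "W \<subseteq> P"
  proof -
    have "(r ^^ k) p0 \<in> P" for k
      using p0 a b by (induction k) (simp_all add: r_def ab)
    then show ?thesis by (auto simp: W_def)
  qed
  have step: "r p \<in> W" if "p \<in> W" for p
  proof -
    obtain k where "p = (r ^^ k) p0" using \<open>p \<in> W\<close> unfolding W_def by blast
    then have "r p = (r ^^ Suc k) p0" by simp
    then show ?thesis unfolding W_def by blast
  qed
  have undo: "b (a (r p)) = p" if "p \<in> P" for p
    using that a b by (simp add: r_def ab)
  then have "inj_on r W"
    using WP by (intro inj_on_inverseI[of _ "\<lambda>p. b (a p)"]) blast
  then have onto: "r ` W = W"
    using step finite_subset[OF WP fin] by (intro endo_inj_surj) auto
  \<comment> \<open>If \<open>a\<close> maps one point of the walk to another, it also maps the earlier of the two to the later.\<close>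
  have apart: "a q \<notin> W" if "q \<in> W" for q
  proof
    assume "a q \<in> W"
    then obtain j k where jk: "q = (r ^^ j) p0" "a q = (r ^^ k) p0"
      using \<open>q \<in> W\<close> unfolding W_def by blast
    have *: False if "x \<in> W" "a x = (r ^^ (i + m)) p0" "x = (r ^^ m) p0" for x i m
      using alternating_walk_avoids_partner[OF a b, of x i] that WP
      by (auto simp: r_def[symmetric] funpow_add)
    show False
    proof (cases "j \<le> k")
      case True
      then show ?thesis using *[of q "k - j" j] jk \<open>q \<in> W\<close> by simp
    next
      case False
      have "a (a q) = q" using \<open>q \<in> W\<close> WP ab(3) by blast
      then show ?thesis using *[of "a q" "j - k" k] jk \<open>a q \<in> W\<close> False by simp
    qed
  qed
  have cross: "b p \<in> W \<longleftrightarrow> a p \<in> W" if "p \<in> P" for p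
  proof
    assume "b p \<in> W"
    then have "r (b p) \<in> W" by (rule step)
    then show "a p \<in> W" using b that by (simp add: r_def ab)
  next
    assume "a p \<in> W"
    then obtain q where q: "q \<in> W" "a p = a (b q)" using onto by (auto simp: r_def)
    have qP: "q \<in> P" using q(1) WP by blast
    have "p = a (a p)" "a (a (b q)) = b q" using a b that qP by (simp_all add: ab)
    then have "p = b q" using q(2) by metis
    then show "b p \<in> W" using q WP b by (auto simp: ab)
  qed
  have "W \<union> a ` W = P"
  proof (rule one)
    show "W \<union> a ` W \<subseteq> P" using WP a by (auto simp: ab)
    show "W \<union> a ` W \<noteq> {}" by (auto simp: W_def)
    show "a ` (W \<union> a ` W) \<subseteq> W \<union> a ` W"
    proof -
      have "a (a q) \<in> W" if "q \<in> W" for q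
        using pairingD(3)[OF a, of q] WP that by auto
      then show ?thesis by blast
    qed
    show "b ` (W \<union> a ` W) \<subseteq> W \<union> a ` W"
    proof -
      have "b q \<in> a ` W" if q: "q \<in> W" for q
      proof -
        have "b q = a (r q)" using q WP a b by (auto simp: r_def ab)
        then show ?thesis using step q by blast
      qed
      moreover have "b (a q) \<in> W" if q: "q \<in> W" for q
        using cross[of "a q"] q WP a by (auto simp: ab)
      ultimately show ?thesis by blast
    qed
  qed
  then have dich: "p \<in> W \<longleftrightarrow> a p \<notin> W" if "p \<in> P" for p
  proof -
    have "a p \<in> W" if "p \<notin> W"
    proof -
      obtain q where "q \<in> W" "p = a q" using \<open>p \<notin> W\<close> \<open>p \<in> P\<close> \<open>W \<union> a ` W = P\<close> by blast
      then show ?thesis using pairingD(3)[OF a, of q] WP by auto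
    qed
    then show ?thesis using apart by blast
  qed
  show ?thesis
    using dich cross by (intro exI[of _ "\<lambda>p. p \<in> W"]) simp
qed simp

section \<open>Circles as orbits\<close>

lemma distinct_ends:
  assumes "card (ends ((t, h), (t', h'))) = 4"
  shows "distinct [t, h, t', h']"
  using assms by (intro card_distinct) simp

fun edge_mate :: "'p edge_arrows \<Rightarrow> 'p \<Rightarrow> 'p" where
  "edge_mate ((t, h), (t', h')) p =
     (if p = t then h else if p = h then t else if p = t' then h' else t')"

text \<open>
  The definite description picks the edge that carries \<open>p\<close>; the value is meaningful only on the
  points of a ribbon graph.
\<close>

definition mate :: "('e, 'p) arrow_presentation \<Rightarrow> 'p \<Rightarrow> 'p" where
  "mate G p = edge_mate (arrows G (THE e. e \<in> edges G \<and> p \<in> ends (arrows G e))) p"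

lemma mate_eq:
  assumes "ribbon_graph G" "e \<in> edges G" "p \<in> ends (arrows G e)"
  shows "mate G p = edge_mate (arrows G e) p"
proof -
  have "(THE e. e \<in> edges G \<and> p \<in> ends (arrows G e)) = e"
  proof (rule the_equality)
    fix f assume "f \<in> edges G \<and> p \<in> ends (arrows G f)"
    then show "f = e" using assms unfolding ribbon_graph_def by (metis disjoint_iff)
  qed (use assms in simp)
  then show ?thesis by (simp add: mate_def)
qed

lemma edge_mate_pairing:
  assumes "card (ends x) = 4"
  shows "pairing (ends x) (edge_mate x)"
proof -
  obtain t h t' h' where x: "x = ((t, h), (t', h'))" by (metis surj_pair)
  have "distinct [t, h, t', h']" using assms unfolding x by (rule distinct_ends)
  then show ?thesis unfolding x pairing_def by auto
qed

lemma pairing_mate: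
  assumes G: "ribbon_graph G"
  shows "pairing (points G) (mate G)"
  unfolding pairing_def
proof
  fix p assume "p \<in> points G"
  then obtain e where e: "e \<in> edges G" "p \<in> ends (arrows G e)" by (auto simp: points_def)
  have "pairing (ends (arrows G e)) (edge_mate (arrows G e))"
    using G e(1) by (intro edge_mate_pairing) (simp add: ribbon_graph_def)
  note m = pairingD[OF this e(2)]
  show "mate G p \<in> points G \<and> mate G p \<noteq> p \<and> mate G (mate G p) = p"
    using m e(1) mate_eq[OF G e] mate_eq[OF G e(1) m(1)] unfolding points_def by auto
qed

lemma pairing_arc: "ribbon_graph G \<Longrightarrow> pairing (points G) (arc G)"
  by (auto simp: pairing_def ribbon_graph_def)

lemma finite_ends: "finite (ends x)"
  by (cases x rule: ends.cases) simp

lemma finite_points: "ribbon_graph G \<Longrightarrow> finite (points G)"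
  by (auto simp: points_def ribbon_graph_def finite_ends)

lemma same_circle_refl [simp]: "(p, p) \<in> same_circle G"
  by (simp add: same_circle_def)

lemma same_circle_sym: "(p, q) \<in> same_circle G \<Longrightarrow> (q, p) \<in> same_circle G"
  unfolding same_circle_def by (metis converse_Un converse_converse rtrancl_converseD sup_commute)

lemma same_circle_trans:
  "(p, q) \<in> same_circle G \<Longrightarrow> (q, s) \<in> same_circle G \<Longrightarrow> (p, s) \<in> same_circle G"
  unfolding same_circle_def by (rule rtrancl_trans)

lemma same_circle_segment:
  assumes "(p, q) \<in> circle_segments G"
  shows "(p, q) \<in> same_circle G" "(q, p) \<in> same_circle G"
  using assms unfolding same_circle_def by auto

lemma same_circle_arc: "p \<in> points G \<Longrightarrow> (p, arc G p) \<in> same_circle G"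
  by (intro same_circle_segment) (auto simp: circle_segments_def)

lemma edge_mate_segment:
  assumes "p \<in> ends x"
  shows "(p, edge_mate x p) \<in> arrow_segments x \<union> (arrow_segments x)\<inverse>"
  using assms by (cases x rule: ends.cases) auto

lemma segment_edge_mate:
  assumes "card (ends x) = 4" "(p, q) \<in> arrow_segments x"
  shows "p \<in> ends x" "q \<in> ends x" "q = edge_mate x p" "p = edge_mate x q"
proof -
  obtain t h t' h' where x: "x = ((t, h), (t', h'))" by (metis surj_pair)
  have "distinct [t, h, t', h']" using assms(1) unfolding x by (rule distinct_ends)
  then show "p \<in> ends x" "q \<in> ends x" "q = edge_mate x p" "p = edge_mate x q"
    using assms(2) unfolding x by auto
qed

lemma same_circle_mate:
  assumes "ribbon_graph G" "p \<in> points G"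
  shows "(p, mate G p) \<in> same_circle G"
proof -
  obtain e where e: "e \<in> edges G" "p \<in> ends (arrows G e)"
    using assms(2) by (auto simp: points_def)
  have "arrow_segments (arrows G e) \<subseteq> circle_segments G"
    using e(1) by (auto simp: circle_segments_def)
  then have "(p, mate G p) \<in> circle_segments G \<or> (mate G p, p) \<in> circle_segments G"
    using edge_mate_segment[OF e(2)] unfolding mate_eq[OF assms(1) e] by blast
  then show ?thesis by (blast intro: same_circle_segment)
qed

text \<open>
  Circles are the orbits of \<open>mate\<close> and \<open>arc\<close>: both maps are involutions, so a set closed under
  them is also closed under traversing segments backwards.
\<close>

lemma same_circle_minimal:
  assumes G: "ribbon_graph G"
    and S: "mate G ` S \<subseteq> S" "arc G ` S \<subseteq> S"
    and pq: "(p, q) \<in> same_circle G" "p \<in> S"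
  shows "q \<in> S"
  using pq(1) unfolding same_circle_def
proof (induction rule: rtrancl_induct)
  case base
  show ?case using pq(2) .
next
  case (step y z)
  then have y: "y \<in> S" by simp
  consider e where "e \<in> edges G" "(y, z) \<in> arrow_segments (arrows G e)"
    | e where "e \<in> edges G" "(z, y) \<in> arrow_segments (arrows G e)"
    | "z = arc G y" | "z \<in> points G" "y = arc G z"
    using step.hyps(2) unfolding circle_segments_def by blast
  then show ?case
  proof cases
    case 1
    then have "card (ends (arrows G e)) = 4" using G by (simp add: ribbon_graph_def)
    note m = segment_edge_mate[OF this 1(2)]
    have "z = mate G y" unfolding mate_eq[OF G 1(1) m(1)] by (rule m(3))
    then show ?thesis using y S by blast
  next
    case 2
    then have "card (ends (arrows G e)) = 4" using G by (simp add: ribbon_graph_def)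
    note m = segment_edge_mate[OF this 2(2)]
    have "z = mate G y" unfolding mate_eq[OF G 2(1) m(2)] by (rule m(4))
    then show ?thesis using y S by blast
  next
    case 3
    then show ?thesis using y S by blast
  next
    case 4
    have "z = arc G y" unfolding 4(2) using pairingD(3)[OF pairing_arc[OF G] 4(1)] by simp
    then show ?thesis using y S by blast
  qed
qed

lemma same_circle_points:
  assumes "ribbon_graph G" "(p, q) \<in> same_circle G" "p \<in> points G"
  shows "q \<in> points G"
  using pairingD(1)[OF pairing_mate[OF assms(1)]] pairingD(1)[OF pairing_arc[OF assms(1)]]
  by (intro same_circle_minimal[OF assms(1) _ _ assms(2,3)]) auto

lemma equiv_same_circle: "equiv UNIV (same_circle G)"
  by (intro equivI refl_onI symI transI) (auto intro: same_circle_sym same_circle_trans)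

lemma same_circle_least:
  assumes "equiv UNIV E" "circle_segments G \<subseteq> E"
  shows "same_circle G \<subseteq> E"
proof -
  have "circle_segments G \<union> (circle_segments G)\<inverse> \<subseteq> E"
    using assms by (auto simp: equiv_def dest: symD)
  then have "same_circle G \<subseteq> E\<^sup>*" unfolding same_circle_def by (rule rtrancl_mono)
  also have "E\<^sup>* = E\<^sup>=" using assms(1) by (simp add: equiv_def trancl_id rtrancl_trancl_reflcl)
  also have "\<dots> = E" using assms(1) by (auto simp: equiv_def refl_on_def)
  finally show ?thesis .
qed

text \<open>
  The traversal of the only circle that carries arrows is the alternating colouring of its end points.
\<close>

lemma orientation_of_bouquet:
  fixes G :: "('e, 'p) arrow_presentation"
  assumes G: "ribbon_graph G" and one: "points G \<times> points G \<subseteq> same_circle G"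
  shows "\<exists>c. vertex_orientation G c"
proof -
  have "\<exists>c :: 'p \<Rightarrow> bool. \<forall>p\<in>points G. c (mate G p) \<noteq> c p \<and> c (arc G p) \<noteq> c p"
  proof (rule alternating_colouring[OF finite_points[OF G] pairing_mate[OF G] pairing_arc[OF G]])
    fix S assume S: "S \<subseteq> points G" "S \<noteq> {}" "mate G ` S \<subseteq> S" "arc G ` S \<subseteq> S"
    then obtain p where p: "p \<in> S" by blast
    show "S = points G"
    proof (intro equalityI S(1) subsetI)
      fix q assume "q \<in> points G"
      then have "(p, q) \<in> same_circle G" using one p S(1) by blast
      then show "q \<in> S" by (rule same_circle_minimal[OF G S(3,4) _ p])
    qed
  qed
  then obtain c :: "'p \<Rightarrow> bool"
    where c: "\<forall>p\<in>points G. c (mate G p) \<noteq> c p \<and> c (arc G p) \<noteq> c p" ..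
  have "alternates c (arrows G e)" if e: "e \<in> edges G" for e
  proof -
    obtain t h t' h' where x: "arrows G e = ((t, h), (t', h'))" by (metis surj_pair)
    have en: "ends (arrows G e) = {t, h, t', h'}" using x by simp
    have d: "distinct [t, h, t', h']"
      using G e by (intro card_distinct) (simp add: ribbon_graph_def flip: en)
    have "mate G t = h" "mate G t' = h'"
      using mate_eq[OF G e, of t] mate_eq[OF G e, of t'] d by (auto simp: x)
    moreover have "t \<in> points G" "t' \<in> points G"
      using ends_subset_points[OF e] by (simp_all add: en)
    ultimately have "c h \<noteq> c t" "c h' \<noteq> c t'" using c by metis+
    then show ?thesis by (simp add: x)
  qed
  then have "vertex_orientation G c" using c by (simp add: vertex_orientation_def)
  then show ?thesis by blast
qed

section \<open>Merging circles by partial duals\<close>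

definition retwist ::
  "('e \<Rightarrow> gen list) \<Rightarrow> ('e, 'p) arrow_presentation \<Rightarrow> ('e, 'p) arrow_presentation" where
  "retwist w G = G\<lparr>arrows := (\<lambda>e. word_edge (w e) (arrows G e))\<rparr>"

lemma retwist_simps [simp]:
  "edges (retwist w G) = edges G" "arc (retwist w G) = arc G" "bare (retwist w G) = bare G"
  "arrows (retwist w G) e = word_edge (w e) (arrows G e)"
  "points (retwist w G) = points G"
  "ribbon_graph (retwist w G) = ribbon_graph G"
  by (auto simp: retwist_def points_def ribbon_graph_def ends_word_edge)

lemma retwist_retwist: "retwist v (retwist w G) = retwist (\<lambda>e. v e @ w e) G"
  by (simp add: retwist_def word_edge_def)

text \<open>
  Deleting an arrow from a circle leaves a path between its ends.  The relation \<open>E\<close> stands for any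
  notion of reachability that uses all the segments but the two arrows of \<open>e\<close>.  The reason is a
  parity count: the set of points of the circle of \<open>t\<close> that are reachable from \<open>t\<close> is paired up
  by \<open>arc\<close>, so it is even; if \<open>h\<close> were not in it, \<open>mate\<close> would pair up all of its points
  except \<open>t\<close>, and it would be odd.  The other arrow of \<open>e\<close> does not interfere because it lies
  on another circle.
\<close>

lemma arrow_circle_survives:
  assumes G: "ribbon_graph G" and e: "e \<in> edges G"
    and x: "arrows G e = ((t, h), (t', h')) \<or> arrows G e = ((t', h'), (t, h))"
    and apart: "(t, t') \<notin> same_circle G"
    and E: "equiv UNIV E"
    and arcs: "\<And>p. p \<in> points G \<Longrightarrow> (p, arc G p) \<in> E"
    and mates: "\<And>f p. f \<in> edges G \<Longrightarrow> f \<noteq> e \<Longrightarrow> p \<in> ends (arrows G f) \<Longrightarrow> (p, mate G p) \<in> E"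
  shows "(t, h) \<in> E"
proof (rule ccontr)
  assume th: "(t, h) \<notin> E"
  have en: "ends (arrows G e) = {t, h, t', h'}" using x by auto
  have pts: "{t, h, t', h'} \<subseteq> points G" using ends_subset_points[OF e] by (simp only: en)
  have d: "distinct [t, h, t', h']"
    using G e by (intro card_distinct) (simp add: ribbon_graph_def flip: en)
  have m: "mate G t = h" "mate G t' = h'" "mate G h = t"
    using mate_eq[OF G e, of t] mate_eq[OF G e, of t'] mate_eq[OF G e, of h] d x
    by (auto simp: en)
  define S where "S = {p \<in> points G. (t, p) \<in> E \<and> (t, p) \<in> same_circle G}"
  note ma = pairingD[OF pairing_mate[OF G]] and ar = pairingD[OF pairing_arc[OF G]]
  have Et: "(p, s) \<in> E" if "(p, q) \<in> E" "(q, s) \<in> E" for p q s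
    using E that by (blast elim: equivE dest: transD)
  have Er: "(t, t) \<in> E" using E by (auto elim!: equivE dest: refl_onD)
  have S: "t \<in> S" "h \<notin> S" "t' \<notin> S"
    using pts th apart Er by (simp_all add: S_def)
  have "(h', t') \<in> same_circle G"
    using same_circle_mate[OF G, of t'] pts m(2) by (simp add: same_circle_sym)
  then have "h' \<notin> S" using apart same_circle_trans[of t h' G t'] by (auto simp: S_def)
  note S = S this
  have fin: "finite S" using finite_points[OF G] by (simp add: S_def)
  have "arc G p \<in> S" if "p \<in> S" for p
    using that ar(1)[of p] Et[OF _ arcs, of t p] same_circle_trans[OF _ same_circle_arc[of p G], of t]
    by (simp add: S_def)
  then have "pairing S (arc G)"
    using ar(2,3) by (simp add: pairing_def S_def)
  then have "even (card S)" by (rule even_card_pairing[OF fin])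
  moreover have "pairing (S - {t}) (mate G)"
    unfolding pairing_def
  proof (intro ballI conjI)
    fix p assume p: "p \<in> S - {t}"
    then have pP: "p \<in> points G" by (simp add: S_def)
    then obtain f where f: "f \<in> edges G" "p \<in> ends (arrows G f)" by (auto simp: points_def)
    have fe: "f \<noteq> e" using f(2) p S by (auto simp: en)
    have "(p, mate G p) \<in> E" by (rule mates[OF f(1) fe f(2)])
    then have "mate G p \<in> S"
      using p ma(1)[OF pP] Et[of t p] same_circle_trans[OF _ same_circle_mate[OF G pP], of t]
      by (simp add: S_def)
    moreover have "mate G p \<noteq> t" using ma(3)[OF pP] m(1) p S by auto
    ultimately show "mate G p \<in> S - {t}" by blast
    show "mate G p \<noteq> p" "mate G (mate G p) = p" using ma[OF pP] by auto
  qed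
  then have "even (card (S - {t}))" using fin by (intro even_card_pairing) auto
  moreover have "card S = Suc (card (S - {t}))"
    using fin S(1) by (rule card.remove)
  ultimately show False by simp
qed

text \<open>
  By \<open>arrow_circle_survives\<close> the two circles, with the arrows of \<open>e\<close> removed, become paths from
  \<open>t\<close> to \<open>h\<close> and from \<open>t'\<close> to \<open>h'\<close>; the arrows of the dual join them into one circle.
\<close>

lemma dual_merges_circles:
  assumes G: "ribbon_graph G" and e: "e \<in> edges G"
    and x: "arrows G e = ((t, h), (t', h'))"
    and apart: "(t, t') \<notin> same_circle G"
  defines "G' \<equiv> retwist (\<lambda>f. if f = e then [Dual] else []) G"
  shows "same_circle G \<subseteq> same_circle G'" "(t, t') \<in> same_circle G'"
proof -
  have G': "ribbon_graph G'" "points G' = points G" "edges G' = edges G" "arc G' = arc G"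
    using G by (simp_all add: G'_def)
  have other: "arrows G' f = arrows G f" if "f \<noteq> e" for f using that by (simp add: G'_def)
  have new: "arrows G' e = ((h, t'), (h', t))" by (simp add: G'_def x)
  have arcs: "(p, arc G p) \<in> same_circle G'" if "p \<in> points G" for p
    using same_circle_arc[of p G'] that by (simp add: G')
  have mates: "(p, mate G p) \<in> same_circle G'"
    if "f \<in> edges G" "f \<noteq> e" "p \<in> ends (arrows G f)" for f p
  proof -
    have "mate G p = mate G' p"
      using mate_eq[OF G that(1,3)] mate_eq[OF G'(1), of f p] that other[OF that(2)]
      by (simp add: G')
    moreover have "p \<in> points G'" using ends_subset_points[OF that(1)] that(3) G' by auto
    ultimately show ?thesis using same_circle_mate[OF G'(1)] by simp
  qed
  have th: "(t, h) \<in> same_circle G'"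
    using x by (intro arrow_circle_survives[OF G e _ apart equiv_same_circle arcs mates]) auto
  \<comment> \<open>The survival lemma is symmetric in the two arrows.\<close>
  have th': "(t', h') \<in> same_circle G'"
    using x apart
    by (intro arrow_circle_survives[OF G e _ _ equiv_same_circle arcs mates, of _ _ t h])
       (auto dest: same_circle_sym)
  have "circle_segments G \<subseteq> same_circle G'"
  proof
    fix s assume "s \<in> circle_segments G"
    then consider p where "p \<in> points G" "s = (p, arc G p)"
      | f where "f \<in> edges G" "f \<noteq> e" "s \<in> arrow_segments (arrows G f)"
      | "s \<in> arrow_segments (arrows G e)"
      unfolding circle_segments_def by blast
    then show "s \<in> same_circle G'"
    proof cases
      case 1
      then show ?thesis using arcs by simp
    next
      case 2
      have "s \<in> circle_segments G'"
        unfolding circle_segments_def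
        by (intro UnI1 UN_I[of f]) (use 2 other[of f] in \<open>simp_all add: G'\<close>)
      then show ?thesis by (cases s) (simp add: same_circle_segment)
    next
      case 3
      then show ?thesis using th th' by (auto simp: x)
    qed
  qed
  then show "same_circle G \<subseteq> same_circle G'"
    by (rule same_circle_least[OF equiv_same_circle])
  have "(h, t') \<in> circle_segments G'" using e new by (force simp: circle_segments_def G')
  then show "(t, t') \<in> same_circle G'"
    using th by (blast intro: same_circle_segment same_circle_trans)
qed

text \<open>
  The choice of words is extremal: it maximises the number of pairs of end points on a common circle.
  An edge between two different circles would allow a larger number by \<open>dual_merges_circles\<close>.
\<close>

lemma exists_twual_of_loops:
  assumes G: "ribbon_graph G"
  shows "\<exists>w. \<forall>e\<in>edges G. ends (arrows G e) \<times> ends (arrows G e) \<subseteq> same_circle (retwist w G)"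
proof -
  let ?PP = "points G \<times> points G"
  let ?size = "\<lambda>w. card (same_circle (retwist w G) \<inter> ?PP)"
  have fin: "finite ?PP" using finite_points[OF G] by simp
  have "\<exists>w. True \<and> (\<forall>v. True \<longrightarrow> ?size v \<le> ?size w)"
    by (rule ex_has_greatest_nat[where b = "Suc (card ?PP)"])
       (auto intro!: le_imp_less_Suc card_mono fin)
  then obtain w where w: "\<And>v. ?size v \<le> ?size w" by blast
  let ?H = "retwist w G"
  have H: "ribbon_graph ?H" using G by simp
  have "ends (arrows G e) \<times> ends (arrows G e) \<subseteq> same_circle ?H" if e: "e \<in> edges G" for e
  proof -
    obtain t h t' h' where x: "arrows ?H e = ((t, h), (t', h'))" by (metis surj_pair)
    have en: "ends (arrows G e) = {t, h, t', h'}"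
      using ends_word_edge[of "w e" "arrows G e"] x by simp
    have eH: "e \<in> edges ?H" using e by simp
    have "(t, t') \<in> same_circle ?H"
    proof (rule ccontr)
      assume apart: "(t, t') \<notin> same_circle ?H"
      define v where "v = (\<lambda>f. (if f = e then [Dual] else []) @ w f)"
      note merge = dual_merges_circles[OF H eH x apart, unfolded retwist_retwist, folded v_def]
      have "(t, t') \<in> ?PP" using ends_subset_points[OF e] by (auto simp: en)
      then have "same_circle ?H \<inter> ?PP \<subset> same_circle (retwist v G) \<inter> ?PP"
        using merge apart by blast
      then have "?size w < ?size v" using fin by (intro psubset_card_mono) auto
      then show False using w[of v] by simp
    qed
    moreover have "arrow_segments (arrows ?H e) \<subseteq> circle_segments ?H"
      using eH unfolding circle_segments_def by blast
    then have "(t, h) \<in> same_circle ?H" "(t', h') \<in> same_circle ?H"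
      unfolding x by (simp_all add: same_circle_segment)
    ultimately have "\<forall>q \<in> {t, h, t', h'}. (t, q) \<in> same_circle ?H"
      using same_circle_trans[of t t' ?H h'] by simp
    then show ?thesis
      unfolding en using same_circle_trans[OF same_circle_sym, of t] by blast
  qed
  then show ?thesis by blast
qed

text \<open>
  The number of components counts bare circles too, so a connected graph with an end point has no bare
  circle.
\<close>

lemma connected_points:
  assumes G: "ribbon_graph G" "connected_rg G" and ne: "points G \<noteq> {}"
  shows "bare G = 0" "points G \<times> points G \<subseteq> same_component G"
proof -
  have fin: "finite (points G // same_component G)"
    using finite_points[OF G(1)] by (simp add: quotient_def)
  have "card (points G // same_component G) \<noteq> 0" using fin ne by (simp add: quotient_def)
  then have "bare G = 0" and one: "card (points G // same_component G) = 1"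
    using G(2) unfolding connected_rg_def num_components_def by linarith+
  then show "bare G = 0" by simp
  show "points G \<times> points G \<subseteq> same_component G"
  proof clarify
    fix p q assume pq: "p \<in> points G" "q \<in> points G"
    have "same_component G `` {p} \<in> points G // same_component G"
      "same_component G `` {q} \<in> points G // same_component G"
      using pq by (auto intro: quotientI)
    then have "same_component G `` {p} = same_component G `` {q}"
      using one by (metis card_1_singletonE singletonD)
    moreover have "q \<in> same_component G `` {q}" by (simp add: same_component_def)
    ultimately show "(p, q) \<in> same_component G" by blast
  qed
qed

text \<open>
  Twisting leaves the arcs and the four end points of every edge in place.  Once each edge lies on one
  circle, every step inside a component of the original graph stays on one circle of the twisted graph.
\<close>

lemma exists_bouquet_twual:
  assumes G: "ribbon_graph G" "connected_rg G" "edges G \<noteq> {}"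
  shows "\<exists>w. points G \<times> points G \<subseteq> same_circle (retwist w G)"
proof -
  obtain w where w: "\<And>e. e \<in> edges G \<Longrightarrow>
      ends (arrows G e) \<times> ends (arrows G e) \<subseteq> same_circle (retwist w G)"
    using exists_twual_of_loops[OF G(1)] by blast
  let ?H = "retwist w G"
  have ne: "points G \<noteq> {}"
  proof -
    obtain e t h t' h' where "e \<in> edges G" "arrows G e = ((t, h), (t', h'))"
      using G(3) by (metis ex_in_conv surj_pair)
    then have "t \<in> points G" using ends_subset_points[of e G] by auto
    then show ?thesis by blast
  qed
  have arr: "arrow_segments x \<subseteq> ends x \<times> ends x" for x :: "'b edge_arrows"
    by (cases x rule: ends.cases) auto
  have arcs: "(p, arc G p) \<in> same_circle ?H" if "p \<in> points G" for p
    using same_circle_arc[of p ?H] that by simp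
  have "circle_segments G \<subseteq> same_circle ?H"
    using w arr arcs unfolding circle_segments_def by blast
  then have "same_circle G \<subseteq> same_circle ?H"
    by (rule same_circle_least[OF equiv_same_circle])
  then have "same_circle G \<union> (\<Union>e\<in>edges G. ends (arrows G e) \<times> ends (arrows G e))
      \<subseteq> same_circle ?H"
    using w by blast
  then have "same_component G \<subseteq> (same_circle ?H)\<^sup>*"
    unfolding same_component_def by (rule rtrancl_mono)
  also have "(same_circle ?H)\<^sup>* = same_circle ?H" by (simp add: same_circle_def)
  finally show ?thesis using connected_points(2)[OF G(1,2) ne] by blast
qed

section \<open>An orientable bouquet in the orbit\<close>

lemma coherent_after_twist:
  assumes "\<not> coherent c x" "alternates c x"
  shows "coherent c (gen_edge Petrial x)"
  using assms by (cases x rule: ends.cases) auto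

text \<open>
  The partial Petrial only reverses an arrow, so it preserves the circles and their orientations, and it
  repairs the edges at which coherence fails.
\<close>

lemma exists_OEB_twual:
  assumes G: "ribbon_graph G" "connected_rg G" "edges G \<noteq> {}"
  shows "\<exists>w. OEB (retwist w G)"
proof -
  obtain w where w: "points G \<times> points G \<subseteq> same_circle (retwist w G)"
    using exists_bouquet_twual[OF G] by blast
  let ?H = "retwist w G"
  obtain c where c: "vertex_orientation ?H c"
    using orientation_of_bouquet[of ?H] G w by auto
  define v where
    "v = (\<lambda>e. (if coherent c (arrows ?H e) then [] else [Petrial]) @ w e)"
  let ?K = "retwist v G"
  have arr: "arrows ?K e = arrows ?H e \<or> arrows ?K e = gen_edge Petrial (arrows ?H e)" for e
    by (simp add: v_def)
  have seg: "arrow_segments (arrows ?H e) \<subseteq>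
      arrow_segments (arrows ?K e) \<union> (arrow_segments (arrows ?K e))\<inverse>" for e
    using arr[of e] by (cases "arrows ?H e" rule: ends.cases) auto
  have "circle_segments ?H \<subseteq> circle_segments ?K \<union> (circle_segments ?K)\<inverse>"
    using seg unfolding circle_segments_def retwist_simps(1,2,5) by blast
  then have "circle_segments ?H \<subseteq> same_circle ?K"
    by (auto intro: same_circle_segment)
  then have circ: "same_circle ?H \<subseteq> same_circle ?K"
    by (rule same_circle_least[OF equiv_same_circle])
  have "alternates c (arrows ?K e)" if "e \<in> edges G" for e
    using arr[of e] c that unfolding vertex_orientation_def retwist_simps(1)
    by (cases "arrows ?H e" rule: ends.cases) auto
  then have vo: "vertex_orientation ?K c" using c by (simp add: vertex_orientation_def)
  have "coherent c (arrows ?K e)" if "e \<in> edges G" for e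
    using coherent_after_twist[of c "arrows ?H e"] c that
    by (auto simp: v_def vertex_orientation_def)
  then have "orientable_rg ?K" using vo unfolding orientable_rg_def by auto
  moreover have "num_vertices ?K = 1"
  proof -
    obtain e t h t' h' where "e \<in> edges G" "arrows G e = ((t, h), (t', h'))"
      using G(3) by (metis ex_in_conv surj_pair)
    then have ne: "t \<in> points G" using ends_subset_points[of e G] by auto
    have "same_circle ?K `` {p} = points G" if "p \<in> points G" for p
    proof (intro equalityI subsetI)
      fix q assume "q \<in> same_circle ?K `` {p}"
      then show "q \<in> points G" using same_circle_points[of ?K p q] that G(1) by simp
    next
      fix q assume "q \<in> points G"
      then show "q \<in> same_circle ?K `` {p}" using w circ that by blast
    qed
    then have "points G // same_circle ?K = {points G}"
      using ne unfolding quotient_def by auto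
    moreover have "bare G = 0" using connected_points(1)[OF G(1,2)] ne by blast
    ultimately show ?thesis by (simp add: num_vertices_def)
  qed
  ultimately show ?thesis using G(1) unfolding OEB_def by auto
qed

section \<open>Order of a conjugate\<close>

lemma (in group) ord_conjugate:
  assumes x: "x \<in> carrier G" and y: "y \<in> carrier G"
  shows "ord (x \<otimes> y \<otimes> inv x) = ord y"
proof -
  have cancel: "inv x \<otimes> (x \<otimes> z) = z" if "z \<in> carrier G" for z
    using m_assoc[OF inv_closed[OF x] x that] x that by simp
  have pow: "(x \<otimes> y \<otimes> inv x) [^] k = x \<otimes> y [^] k \<otimes> inv x" for k :: nat
    using x y by (induction k) (simp_all add: m_assoc cancel)
  have one: "x \<otimes> z \<otimes> inv x = \<one> \<longleftrightarrow> z = \<one>" if z: "z \<in> carrier G" for z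
  proof
    assume "x \<otimes> z \<otimes> inv x = \<one>"
    then have "inv x \<otimes> (x \<otimes> (z \<otimes> inv x)) = inv x"
      using x z by (simp add: m_assoc)
    then have "z \<otimes> inv x = \<one> \<otimes> inv x" using cancel x z by simp
    then show "z = \<one>" using x z by (simp only: r_cancel inv_closed one_closed)
  qed (use x in simp)
  have "(x \<otimes> y \<otimes> inv x) [^] k = \<one> \<longleftrightarrow> ord y dvd k" for k :: nat
    unfolding pow by (simp only: one[OF nat_pow_closed[OF y]] pow_eq_id[OF y])
  then show ?thesis using x y by (simp add: ord_unique)
qed

lemma (in group) ord_eq_prime:
  fixes p :: nat
  assumes "x \<in> carrier G" "x \<noteq> \<one>" "x [^] p = \<one>" "Factorial_Ring.prime p"
  shows "ord x = p"
proof -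
  have "ord x dvd p" using assms(1,3) pow_eq_id by blast
  then have "ord x = 1 \<or> ord x = p" using assms(4) by (simp add: prime_nat_iff)
  then show ?thesis using assms(1,2) ord_eq_1 by blast
qed

section \<open>The action by twists\<close>

lemma group_twist_power: "group (twist_power n)"
  by (simp add: sym_group_is_group)

lemma constant_twist_carrier:
  "s \<in> carrier twist_group \<Longrightarrow> constant_twist n s \<in> carrier (twist_power n)"
  by auto

lemma word_elt_carrier: "word_elt w \<in> carrier twist_group"
proof (induction w)
  case (Cons g w)
  have "gen_elt g \<in> carrier twist_group"
    using delta_carrier tau_carrier by (cases g) simp_all
  then show ?case
    using Cons by (simp only: word_elt_simps sym_group_carrier permutes_compose)
qed (simp only: word_elt_simps sym_group_carrier permutes_id)

lemma word_elt_append: "word_elt (u @ v) = word_elt u \<circ> word_elt v"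
  by (induction u) (simp_all add: comp_assoc)

lemma retwist_ordered:
  "(retwist w G, l) \<in> ordered_graphs n \<longleftrightarrow> (G, l) \<in> ordered_graphs n"
  by (simp add: ordered_graphs_def)

lemma twist_in_twuality_group: "(\<gamma>, \<one>\<^bsub>sym_group n\<^esub>) \<in> carrier (twuality_group n) \<longleftrightarrow> \<gamma> \<in> carrier (twist_power n)"
  using group.is_monoid[OF sym_group_is_group, of n]
  by (auto simp: twuality_group_def intro: monoid.one_closed)

text \<open>
  The words \<open>w\<close> are free to differ from those chosen in \<open>elt_edge\<close>: two words for the same group
  element give arrows that are variants of each other, hence the identity is an isomorphism.
\<close>

lemma act_iso_class_retwist:
  assumes Gl: "(G, l) \<in> ordered_graphs n" and \<gamma>: "\<gamma> \<in> carrier (twist_power n)"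
    and w: "\<And>i. i \<in> {1..n} \<Longrightarrow> word_elt (w (l i)) = \<gamma> i"
  shows "act n (\<gamma>, \<one>\<^bsub>sym_group n\<^esub>) (iso_class n (G, l)) = iso_class n (retwist w G, l)"
proof -
  let ?a = "(\<gamma>, \<one>\<^bsub>sym_group n\<^esub>)"
  have a: "?a \<in> carrier (twuality_group n)" using \<gamma> by (simp only: twist_in_twuality_group)
  have "inv\<^bsub>sym_group n\<^esub> \<one>\<^bsub>sym_group n\<^esub> = id"
    by (metis group.is_monoid monoid.inv_one sym_group_is_group sym_group_one)
  then have rep: "act_rep n ?a (G, l) = (Gamma n \<gamma> l G, l)"
    by (simp add: act_rep_def Let_def)
  have closed: "(Gamma n \<gamma> l G, l) \<in> ordered_graphs n"
    using act_rep_closed[OF a Gl] by (simp only: rep)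
  have l: "bij_betw l {1..n} (edges G)" using Gl by (simp add: ordered_graphs_def)
  have var: "arrows (Gamma n \<gamma> l G) e \<in> edge_variants (arrows (retwist w G) e)"
    and ends: "ends (arrows (Gamma n \<gamma> l G) e) = ends (arrows G e)"
    if e: "e \<in> edges G" for e
  proof -
    have "e \<in> l ` {1..n}" using l e by (simp add: bij_betw_def)
    then obtain i where i: "i \<in> {1..n}" "e = l i" by blast
    then have "inv_into {1..n} l e = i" using l by (simp add: bij_betw_def inv_into_f_f)
    then have arr: "arrows (Gamma n \<gamma> l G) e = elt_edge (\<gamma> i) (arrows G e)"
      using e by (simp add: Gamma_def)
    have \<gamma>i: "\<gamma> i \<in> carrier twist_group" using \<gamma> i(1) by auto
    show "ends (arrows (Gamma n \<gamma> l G) e) = ends (arrows G e)"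
      using ends_elt_edge[OF \<gamma>i] by (simp add: arr)
    obtain v where "word_elt v = \<gamma> i" "elt_edge (\<gamma> i) (arrows G e) = word_edge v (arrows G e)"
      using elt_edge_word[OF \<gamma>i] by metis
    then show "arrows (Gamma n \<gamma> l G) e \<in> edge_variants (arrows (retwist w G) e)"
      using w[OF i(1)] i(2) arr by (simp add: word_edge_well_defined)
  qed
  have "points (Gamma n \<gamma> l G) = points G"
    using ends by (simp add: points_def Gamma_def)
  then have "isomorphism_via id (Gamma n \<gamma> l G) (retwist w G)"
    using var unfolding isomorphism_via_def
    by (intro conjI exI[of _ id]) (auto simp: Gamma_def prod.map_id0)
  then have "((Gamma n \<gamma> l G, l), (retwist w G, l)) \<in> ordered_iso n"
    using closed Gl unfolding ordered_iso_def by (auto simp: retwist_ordered)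
  then have "iso_class n (Gamma n \<gamma> l G, l) = iso_class n (retwist w G, l)"
    unfolding iso_class_def by (rule equiv_class_eq[OF equiv_ordered_iso])
  then show ?thesis using act_iso_class[OF a Gl] by (simp only: rep)
qed

lemma words_of_twist:
  assumes Gl: "(G, l) \<in> ordered_graphs n" and \<gamma>: "\<gamma> \<in> carrier (twist_power n)"
  shows "\<exists>w. \<forall>i\<in>{1..n}. word_elt (w (l i)) = \<gamma> i"
proof -
  have "\<forall>i\<in>{1..n}. \<exists>u. word_elt u = \<gamma> i"
    using \<gamma> word_elt_surj by (auto simp: PiE_iff)
  then obtain u where u: "\<forall>i\<in>{1..n}. word_elt (u i) = \<gamma> i" by (rule bchoice[THEN exE])
  have "inv_into {1..n} l (l i) = i" if "i \<in> {1..n}" for i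
    using Gl that by (simp add: ordered_graphs_def bij_betw_def inv_into_f_f)
  then show ?thesis using u by (intro exI[of _ "\<lambda>e. u (inv_into {1..n} l e)"]) simp
qed

text \<open>
  Concatenating words realises the product of twists, and by \<open>act_iso_class_retwist\<close> any words
  for the two factors may be used.
\<close>

lemma act_act:
  assumes Gl: "(G, l) \<in> ordered_graphs n"
    and \<alpha>: "\<alpha> \<in> carrier (twist_power n)" and \<beta>: "\<beta> \<in> carrier (twist_power n)"
  shows "act n (\<alpha>, \<one>\<^bsub>sym_group n\<^esub>) (act n (\<beta>, \<one>\<^bsub>sym_group n\<^esub>) (iso_class n (G, l))) =
    act n (\<alpha> \<otimes>\<^bsub>twist_power n\<^esub> \<beta>, \<one>\<^bsub>sym_group n\<^esub>) (iso_class n (G, l))"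
proof -
  obtain v where v: "\<And>i. i \<in> {1..n} \<Longrightarrow> word_elt (v (l i)) = \<alpha> i"
    using words_of_twist[OF Gl \<alpha>] by blast
  obtain w where w: "\<And>i. i \<in> {1..n} \<Longrightarrow> word_elt (w (l i)) = \<beta> i"
    using words_of_twist[OF Gl \<beta>] by blast
  have Hl: "(retwist w G, l) \<in> ordered_graphs n" using Gl by (simp only: retwist_ordered)
  have "\<alpha> \<otimes>\<^bsub>twist_power n\<^esub> \<beta> \<in> carrier (twist_power n)"
    using group_twist_power \<alpha> \<beta> by (metis group.is_monoid monoid.m_closed)
  moreover have "word_elt (v (l i) @ w (l i)) = (\<alpha> \<otimes>\<^bsub>twist_power n\<^esub> \<beta>) i" if "i \<in> {1..n}" for i
    using v[OF that] w[OF that] that by (simp add: word_elt_append sym_group_mult)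
  ultimately show ?thesis
    using act_iso_class_retwist[OF Gl \<beta> w] act_iso_class_retwist[OF Hl \<alpha> v]
      act_iso_class_retwist[OF Gl, of _ "\<lambda>e. v e @ w e"]
    by (simp only: retwist_retwist)
qed

lemma act_one:
  assumes "(G, l) \<in> ordered_graphs n"
  shows "act n (\<one>\<^bsub>twist_power n\<^esub>, \<one>\<^bsub>sym_group n\<^esub>) (iso_class n (G, l)) = iso_class n (G, l)"
proof -
  have "\<one>\<^bsub>twist_power n\<^esub> \<in> carrier (twist_power n)"
    using group_twist_power by (metis group.is_monoid monoid.one_closed)
  moreover have "word_elt [] = \<one>\<^bsub>twist_power n\<^esub> i" if "i \<in> {1..n}" for i
    using that by (simp add: sym_group_one)
  moreover have "retwist (\<lambda>e. []) G = G" by (simp add: retwist_def)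
  ultimately show ?thesis using act_iso_class_retwist[OF assms, of _ "\<lambda>e. []"] by metis
qed

lemma act_conjugate:
  assumes Gl: "(G, l) \<in> ordered_graphs n"
    and u: "u \<in> carrier (twist_power n)" and \<alpha>: "\<alpha> \<in> carrier (twist_power n)"
    and self: "canonically_self n u (G, l)"
  shows "act n (\<alpha> \<otimes>\<^bsub>twist_power n\<^esub> u \<otimes>\<^bsub>twist_power n\<^esub> inv\<^bsub>twist_power n\<^esub> \<alpha>, \<one>\<^bsub>sym_group n\<^esub>)
      (act n (\<alpha>, \<one>\<^bsub>sym_group n\<^esub>) (iso_class n (G, l))) =
    act n (\<alpha>, \<one>\<^bsub>sym_group n\<^esub>) (iso_class n (G, l))"
proof -
  interpret T: group "twist_power n" by (rule group_twist_power)
  have inv: "inv\<^bsub>twist_power n\<^esub> \<alpha> \<in> carrier (twist_power n)" using \<alpha> by (rule T.inv_closed)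
  have \<gamma>: "\<alpha> \<otimes>\<^bsub>twist_power n\<^esub> u \<otimes>\<^bsub>twist_power n\<^esub> inv\<^bsub>twist_power n\<^esub> \<alpha> \<in> carrier (twist_power n)"
    by (intro T.m_closed inv \<alpha> u)
  have "\<alpha> \<otimes>\<^bsub>twist_power n\<^esub> u \<otimes>\<^bsub>twist_power n\<^esub> inv\<^bsub>twist_power n\<^esub> \<alpha> \<otimes>\<^bsub>twist_power n\<^esub> \<alpha> =
      \<alpha> \<otimes>\<^bsub>twist_power n\<^esub> u"
    by (simp only: T.m_assoc T.m_closed inv \<alpha> u T.l_inv T.r_one)
  then show ?thesis
    using act_act[OF Gl \<gamma> \<alpha>] act_act[OF Gl \<alpha> u] self unfolding canonically_self_def by simp
qed

text \<open>
  The OEB is the image of the graph under some \<open>\<alpha>\<close>, and the required twist is the conjugate of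
  \<open>u\<close> by \<open>\<alpha>\<close>.
\<close>

lemma OEB_in_orbit:
  fixes G :: "('e, 'p) arrow_presentation"
  assumes n: "n \<ge> 1" and Gl: "(G, l) \<in> ordered_graphs n" and conn: "connected_rg G"
    and u: "u \<in> carrier (twist_power n)" and self: "canonically_self n u (G, l)"
  shows "\<exists>(H :: ('e, 'p) arrow_presentation) m.
    (H, m) \<in> ordered_graphs n \<and> OEB H \<and> iso_class n (G, l) \<in> Orb n (H, m) \<and>
    (\<exists>\<gamma> \<in> carrier (twist_power n).
       group.ord (twist_power n) \<gamma> = group.ord (twist_power n) u \<and> canonically_self n \<gamma> (H, m))"
proof -
  interpret T: group "twist_power n" by (rule group_twist_power)
  have "ribbon_graph G" "edges G \<noteq> {}" using Gl n by (auto simp: ordered_graphs_def)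
  then obtain w where w: "OEB (retwist w G)" using exists_OEB_twual conn by metis
  define \<alpha> where "\<alpha> = (\<lambda>i\<in>{1..n}. word_elt (w (l i)))"
  have \<alpha>: "\<alpha> \<in> carrier (twist_power n)"
    using word_elt_carrier by (simp add: \<alpha>_def)
  have inv: "inv\<^bsub>twist_power n\<^esub> \<alpha> \<in> carrier (twist_power n)" using \<alpha> by (rule T.inv_closed)
  have H: "act n (\<alpha>, \<one>\<^bsub>sym_group n\<^esub>) (iso_class n (G, l)) = iso_class n (retwist w G, l)"
    using Gl \<alpha> by (rule act_iso_class_retwist) (simp add: \<alpha>_def)
  have "iso_class n (G, l) =
      act n (inv\<^bsub>twist_power n\<^esub> \<alpha>, \<one>\<^bsub>sym_group n\<^esub>) (iso_class n (retwist w G, l))"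
    using act_act[OF Gl inv \<alpha>] act_one[OF Gl] T.l_inv[OF \<alpha>] H by metis
  moreover have "(inv\<^bsub>twist_power n\<^esub> \<alpha>, \<one>\<^bsub>sym_group n\<^esub>) \<in> carrier (twuality_group n)"
    using inv by (simp only: twist_in_twuality_group)
  ultimately have orb: "iso_class n (G, l) \<in> Orb n (retwist w G, l)"
    unfolding Orb_def orbit_def by blast
  let ?\<gamma> = "\<alpha> \<otimes>\<^bsub>twist_power n\<^esub> u \<otimes>\<^bsub>twist_power n\<^esub> inv\<^bsub>twist_power n\<^esub> \<alpha>"
  have "?\<gamma> \<in> carrier (twist_power n)" by (intro T.m_closed inv \<alpha> u)
  moreover have "group.ord (twist_power n) ?\<gamma> = group.ord (twist_power n) u"
    by (rule T.ord_conjugate[OF \<alpha> u])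
  moreover have "canonically_self n ?\<gamma> (retwist w G, l)"
    using act_conjugate[OF Gl u \<alpha> self] unfolding canonically_self_def H .
  ultimately show ?thesis using w orb Gl retwist_ordered by metis
qed

lemma constant_twist_pow:
  "constant_twist n s [^]\<^bsub>twist_power n\<^esub> (k :: nat) = constant_twist n (s [^]\<^bsub>twist_group\<^esub> k)"
  by (induction k) auto

lemma ord_constant_twist:
  assumes "n \<ge> 1" "s \<in> carrier twist_group"
    and p: "Factorial_Ring.prime p" "s \<noteq> id" "s [^]\<^bsub>twist_group\<^esub> p = id"
  shows "group.ord (twist_power n) (constant_twist n s) = p"
proof (rule group.ord_eq_prime[OF group_twist_power])
  show "constant_twist n s \<in> carrier (twist_power n)"
    using assms(2) by (rule constant_twist_carrier)
  have "constant_twist n s 1 \<noteq> \<one>\<^bsub>twist_power n\<^esub> 1"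
    using assms(1) p(2) by (simp add: sym_group_one)
  then show "constant_twist n s \<noteq> \<one>\<^bsub>twist_power n\<^esub>" by metis
  show "constant_twist n s [^]\<^bsub>twist_power n\<^esub> p = \<one>\<^bsub>twist_power n\<^esub>"
    unfolding constant_twist_pow p(3) by (simp add: sym_group_one)
qed (rule p(1))

lemma twist_involutions:
  "delta [^]\<^bsub>twist_group\<^esub> (2 :: nat) = id" "tau [^]\<^bsub>twist_group\<^esub> (2 :: nat) = id"
  "(tau \<circ> delta \<circ> tau) [^]\<^bsub>twist_group\<^esub> (2 :: nat) = id"
  "delta \<noteq> id" "tau \<noteq> id" "tau \<circ> delta \<circ> tau \<noteq> id"
proof -
  have "delta 1 \<noteq> id 1" "tau 2 \<noteq> id 2" "(tau \<circ> delta \<circ> tau) 1 \<noteq> id 1"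
    by (simp_all add: delta_def tau_def transpose_def)
  then show "delta \<noteq> id" "tau \<noteq> id" "tau \<circ> delta \<circ> tau \<noteq> id" by metis+
qed (auto simp: numeral_2_eq_2 sym_group_def nat_pow_def delta_def tau_def transpose_def fun_eq_iff)

lemma twist_trialities:
  "(delta \<circ> tau) [^]\<^bsub>twist_group\<^esub> (3 :: nat) = id" "(tau \<circ> delta) [^]\<^bsub>twist_group\<^esub> (3 :: nat) = id"
  "delta \<circ> tau \<noteq> id" "tau \<circ> delta \<noteq> id"
proof -
  have "(delta \<circ> tau) 1 \<noteq> id 1" "(tau \<circ> delta) 1 \<noteq> id 1"
    by (simp_all add: delta_def tau_def transpose_def)
  then show "delta \<circ> tau \<noteq> id" "tau \<circ> delta \<noteq> id" by metis+
qed (auto simp: numeral_3_eq_3 sym_group_def nat_pow_def delta_def tau_def transpose_def fun_eq_iff)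

theorem theorem6p3:
  fixes n :: nat
    and G :: "('e, 'p) arrow_presentation"
    and lG :: "nat \<Rightarrow> 'e"
  assumes "n \<ge> 1"
    and "(G, lG) \<in> ordered_graphs n"
    and "connected_rg G"
  shows "(canonically_self_dual n (G, lG) \<or> canonically_self_Petrial n (G, lG) \<or>
            canonically_self_Wilsonial n (G, lG) \<longrightarrow>
          (\<exists>(H :: ('e, 'p) arrow_presentation) lH.
             (H, lH) \<in> ordered_graphs n \<and> OEB H \<and>
             iso_class n (G, lG) \<in> Orb n (H, lH) \<and>
             (\<exists>\<gamma>' \<in> carrier (twist_power n).
                group.ord (twist_power n) \<gamma>' = 2 \<and> canonically_self n \<gamma>' (H, lH)))) \<and>
         (canonically_self_trial n (G, lG) \<longrightarrow>
          (\<exists>(H :: ('e, 'p) arrow_presentation) lH.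
             (H, lH) \<in> ordered_graphs n \<and> OEB H \<and>
             iso_class n (G, lG) \<in> Orb n (H, lH) \<and>
             (\<exists>\<gamma>' \<in> carrier (twist_power n).
                group.ord (twist_power n) \<gamma>' = 3 \<and> canonically_self n \<gamma>' (H, lH))))"
proof -
  have carr: "tau \<circ> delta \<circ> tau \<in> carrier twist_group" "delta \<circ> tau \<in> carrier twist_group"
    "tau \<circ> delta \<in> carrier twist_group"
    using delta_carrier tau_carrier by (simp_all add: sym_group_carrier permutes_compose)
  have bouquet: "\<exists>(H :: ('e, 'p) arrow_presentation) lH.
      (H, lH) \<in> ordered_graphs n \<and> OEB H \<and> iso_class n (G, lG) \<in> Orb n (H, lH) \<and>
      (\<exists>\<gamma>' \<in> carrier (twist_power n).
         group.ord (twist_power n) \<gamma>' = p \<and> canonically_self n \<gamma>' (H, lH))"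
    if "canonically_self n (constant_twist n s) (G, lG)" "s \<in> carrier twist_group"
      "Factorial_Ring.prime p" "s \<noteq> id" "s [^]\<^bsub>twist_group\<^esub> p = id" for s p
    using OEB_in_orbit[OF assms constant_twist_carrier[OF that(2)] that(1)]
    unfolding ord_constant_twist[OF assms(1) that(2-5)] .
  have primes: "Factorial_Ring.prime (2 :: nat)" "Factorial_Ring.prime (3 :: nat)" by simp_all
  note self = bouquet[OF _ delta_carrier primes(1) twist_involutions(4,1)]
    bouquet[OF _ tau_carrier primes(1) twist_involutions(5,2)]
    bouquet[OF _ carr(1) primes(1) twist_involutions(6,3)]
    bouquet[OF _ carr(2) primes(2) twist_trialities(3,1)]
    bouquet[OF _ carr(3) primes(2) twist_trialities(4,2)]
  show ?thesis
    unfolding canonically_self_dual_def canonically_self_Petrial_def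
      canonically_self_Wilsonial_def canonically_self_trial_def sym_group_mult
    by (intro conjI impI; elim disjE) (erule self)+
qed

end
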